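(* Let $n,m\ge 1$, let $D\subset\mathbb{R}^n$ be a domain, let $f:D\to\mathbb{R}^m$ be a smooth map, and let $\Sigma=\{(x,f(x)):x\in D\}\subset\mathbb{R}^{n+m}$ be the graph of $f$. Let $c=1$ if $m\le 2$ or $n\le 2$, and $c=\min(m-1,n-1)$ in all other cases. If $\Sigma$ is a minimal submanifold of $\mathbb{R}^{n+m}$ and $$*\Omega\ \ge\ \frac{c}{2\left(c+1-\sqrt{1+c}\right)}$$ at every point, where $*\Omega=\dfrac{1}{\sqrt{\det\left(I+(df)^Tdf\right)}}$, then $\Sigma$ is stable.
   Context: Here $\Omega$ is the volume form $dx^1\wedge\cdots\wedge dx^n$ of $\mathbb{R}^n$, extended to a parallel $n$-form on $\mathbb{R}^{n+m}$, and $*\Omega$ is the function on $\Sigma$ obtained by applying the Hodge star of $\Sigma$ to $\Omega|_\Sigma$; it is the Jacobian of the projection $\Sigma\to D$, and equals $\frac{1}{\sqrt{\det(I+(df)^Tdf)}}=\frac{1}{\sqrt{\prod_i(1+\lambda_i^2)}}$, where $\lambda_i$ are the singular values of $df$. A minimal submanifold $\Sigma\subset\mathbb{R}^{n+m}$ (mean curvature vector zero) is called stable if the second derivative of the volume functional with respect to any compactly supported normal variation field is nonnegative. Equivalently, for every compactly supported normal vector field $V$ on $\Sigma$, $$\int_\Sigma \|\nabla^N V\|^2\,dv\ \ge\ \int_\Sigma B(V,V)\,dv ,$$ where $dv$ is the induced volume form, $\nabla^N V$ is the covariant derivative of $V$ as a section of the normal bundle, and, in local coordinates $\{x^i\}$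 on $\Sigma$ with position vector $F$ and induced metric $g_{ij}$, $$B(V,V)=\sum_{i,j,k,l} g^{ik}g^{jl}\Big\langle \frac{\partial^2F}{\partial x^i\partial x^j},V\Big\rangle\Big\langle \frac{\partial^2F}{\partial x^k\partial x^l},V\Big\rangle .$$ *)

theory Defs
  imports "HOL-Analysis.Analysis"
begin

text \<open>
  Smoothness (\<open>C\<^sup>\<infinity>\<close>) on an open set: all iterated directional derivatives exist, as Frechet
  derivatives.  Continuity of the derivatives of order \<open>k\<close> follows from differentiability
  at order \<open>k + 1\<close>.
\<close>

primrec diff_times_on ::
  "nat \<Rightarrow> 'a::real_normed_vector set \<Rightarrow> ('a \<Rightarrow> 'b::real_normed_vector) \<Rightarrow> bool" where
  "diff_times_on 0 S f \<longleftrightarrow> continuous_on S f"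
| "diff_times_on (Suc k) S f \<longleftrightarrow>
     (\<forall>x\<in>S. f differentiable (at x)) \<and>
     (\<forall>v. diff_times_on k S (\<lambda>x. frechet_derivative f (at x) v))"

definition smooth_on ::
  "'a::real_normed_vector set \<Rightarrow> ('a \<Rightarrow> 'b::real_normed_vector) \<Rightarrow> bool" where
  "smooth_on S f \<longleftrightarrow> (\<forall>k. diff_times_on k S f)"

text \<open>
  A submanifold is given by a global parametrization \<open>F\<close>, an immersion of an open subset of
  \<open>real ^ 'n\<close> into a Euclidean space; fields along the submanifold are functions of the
  parameter \<open>x\<close>.
\<close>

definition partial_deriv ::
  "(real ^ 'n \<Rightarrow> 'a::euclidean_space) \<Rightarrow> 'n \<Rightarrow> real ^ 'n \<Rightarrow> 'a" where
  "partial_deriv F i x = frechet_derivative F (at x) (axis i 1)"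

definition induced_metric ::
  "(real ^ 'n \<Rightarrow> 'a::euclidean_space) \<Rightarrow> real ^ 'n \<Rightarrow> real ^ 'n ^ 'n" where
  "induced_metric F x = (\<chi> i j. partial_deriv F i x \<bullet> partial_deriv F j x)"

definition inverse_metric ::
  "(real ^ 'n \<Rightarrow> 'a::euclidean_space) \<Rightarrow> real ^ 'n \<Rightarrow> real ^ 'n ^ 'n" where
  "inverse_metric F x = matrix_inv (induced_metric F x)"

definition normal_part ::
  "(real ^ 'n \<Rightarrow> 'a::euclidean_space) \<Rightarrow> real ^ 'n \<Rightarrow> 'a \<Rightarrow> 'a" where
  "normal_part F x v =
     v - (\<Sum>i\<in>UNIV. \<Sum>j\<in>UNIV.
            (inverse_metric F x $ i $ j * (v \<bullet> partial_deriv F j x)) *\<^sub>R partial_deriv F i x)"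

definition second_fundamental_form ::
  "(real ^ 'n \<Rightarrow> 'a::euclidean_space) \<Rightarrow> 'n \<Rightarrow> 'n \<Rightarrow> real ^ 'n \<Rightarrow> 'a" where
  "second_fundamental_form F i j x =
     normal_part F x (partial_deriv (partial_deriv F j) i x)"

definition mean_curvature_vector ::
  "(real ^ 'n \<Rightarrow> 'a::euclidean_space) \<Rightarrow> real ^ 'n \<Rightarrow> 'a" where
  "mean_curvature_vector F x =
     (\<Sum>i\<in>UNIV. \<Sum>j\<in>UNIV.
        inverse_metric F x $ i $ j *\<^sub>R second_fundamental_form F i j x)"

definition minimal_on ::
  "(real ^ 'n) set \<Rightarrow> (real ^ 'n \<Rightarrow> 'a::euclidean_space) \<Rightarrow> bool" where
  "minimal_on D F \<longleftrightarrow> (\<forall>x\<in>D. mean_curvature_vector F x = 0)"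

definition volume_over ::
  "(real ^ 'n) set \<Rightarrow> (real ^ 'n \<Rightarrow> 'a::euclidean_space) \<Rightarrow> real" where
  "volume_over K F = (LINT x:K|lborel. sqrt (det (induced_metric F x)))"

definition normal_field_on ::
  "(real ^ 'n) set \<Rightarrow> (real ^ 'n \<Rightarrow> 'a::euclidean_space) \<Rightarrow> (real ^ 'n \<Rightarrow> 'a) \<Rightarrow> bool" where
  "normal_field_on D F V \<longleftrightarrow> (\<forall>x\<in>D. \<forall>i. V x \<bullet> partial_deriv F i x = 0)"

text \<open>
  The total volume may be infinite, so the volume of the variation \<open>F + t V\<close> is taken over a
  compact \<open>K\<close> outside of which \<open>V\<close> vanishes.  Existence of the second derivative
  at \<open>t = 0\<close> is part of the definition.
\<close>

definition stable_on ::
  "(real ^ 'n) set \<Rightarrow> (real ^ 'n \<Rightarrow> 'a::euclidean_space) \<Rightarrow> bool" where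
  "stable_on D F \<longleftrightarrow>
     (\<forall>V K. smooth_on D V \<and> normal_field_on D F V \<and>
            compact K \<and> K \<subseteq> D \<and> (\<forall>x\<in>D - K. V x = 0) \<longrightarrow>
        (\<exists>A' s.
           (\<forall>\<^sub>F t in nhds 0.
              ((\<lambda>t. volume_over K (\<lambda>x. F x + t *\<^sub>R V x)) has_real_derivative A' t) (at t)) \<and>
           (A' has_real_derivative s) (at 0) \<and>
           s \<ge> 0))"

definition graph_map ::
  "(real ^ 'n \<Rightarrow> real ^ 'm) \<Rightarrow> real ^ 'n \<Rightarrow> (real ^ 'n) \<times> (real ^ 'm)" where
  "graph_map f x = (x, f x)"

text \<open>
  The function \<open>*\<Omega>\<close> on the graph of \<open>f\<close>, in the parameter \<open>x\<close>;
  \<^const>\<open>jacobian\<close> is the library's matrix of the Frechet derivative.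
\<close>

definition star_Omega :: "(real ^ 'n \<Rightarrow> real ^ 'm) \<Rightarrow> real ^ 'n \<Rightarrow> real" where
  "star_Omega f x =
     1 / sqrt (det (mat 1 + transpose (jacobian f (at x)) ** jacobian f (at x)))"

definition stability_const :: "nat \<Rightarrow> nat \<Rightarrow> real" where
  "stability_const n m =
     (if m \<le> 2 \<or> n \<le> 2 then 1 else min (real m - 1) (real n - 1))"

end

(* The second variation of volume is a quadratic form in the derivative of the variation field, for
   any field V along the graph.  Write V = W + T with T tangent to the graph and W vertical (the
   tangent component T = dF(tau) is determined by the horizontal component tau of V).  Minimality is
   preserved under reparametrization, so T solves the linearized minimal surface system; hence the
   second variation at V equals the second variation at W, up to a divergence.  For the vertical field
   W the integrand is the Hessian of the area integrand p |-> sqrt (det (I + p^T p)) at p = df in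
   direction dW.  In a basis which diagonalizes (df)^T df this Hessian is nonnegative as soon as
   det (I + (df)^T df) <= 4, that is, if *Omega >= 1/2, and the bound required of *Omega is at least
   1/2 for every c > 0. *)

theory Submission
  imports Defs
begin

section \<open>Derivatives of the determinant and of the matrix inverse\<close>

text \<open>Area is studied on frames (\<open>n\<close>-tuples of vectors) before any map enters:
  \<open>flux\<close> is the gradient of \<open>vol\<close>, \<open>flux_deriv\<close> its Hessian,
  and the second variation is the integral of this Hessian at \<open>jac F\<close> in direction
  \<open>jac V\<close>. The obstacle is that the Hessian has no sign along tangential directions: in
  direction \<open>row_comb B X\<close> it equals \<open>vol X\<close> times tr(B)^2 - tr(B^2),
  which is indefinite for n >= 2. The equivariance of \<open>flux\<close> under changes of frame,
  together with \<open>flux (jac F)\<close> being divergence-free, turns such terms into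
  divergences. The mixed term of W and T is absorbed at the same time by pairing T with 2W + T. The
  number 4 comes from (1 + p)(1 + q) >= (1 + sqrt(p q))^2: under this bound two distinct singular
  values of df have product at most 1, so at most one of them exceeds 1. That one gives the Hessian
  a negative diagonal coefficient, which the squared trace term has to compensate.\<close>

lemma bounded_bilinear_matrix_mult:
  "bounded_bilinear ((**) :: real^'n^'m \<Rightarrow> real^'k^'n \<Rightarrow> real^'k^'m)"
  by (subst bilinear_conv_bounded_bilinear[symmetric])
    (auto simp: bilinear_def matrix_matrix_mult_def vec_eq_iff sum.distrib sum_distrib_left
      algebra_simps intro!: linearI)

lemma bounded_linear_trace: "bounded_linear (trace :: real^'n^'n \<Rightarrow> real)"
  by (subst linear_conv_bounded_linear[symmetric])
    (auto simp: trace_def sum.distrib sum_distrib_left intro!: linearI)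

text \<open>In the Leibniz expansion only the identity permutation contributes: any other
  permutation moves at least two indices, so after the product rule removes one factor an
  off-diagonal zero of the identity matrix remains.\<close>

lemma det_has_derivative_mat_1: "(det has_derivative trace) (at (mat 1 :: real^'n^'n))"
proof -
  have summand: "((\<lambda>A. of_int (sign p) * (\<Prod>i\<in>UNIV. A $ i $ p i)) has_derivative
      (\<lambda>E. if p = id then trace E else 0)) (at (mat 1 :: real^'n^'n))"
    if p: "p permutes (UNIV :: 'n set)" for p
  proof -
    have prod: "((\<lambda>A. \<Prod>i\<in>UNIV. A $ i $ p i) has_derivative
        (\<lambda>E. \<Sum>i\<in>UNIV. E $ i $ p i * (\<Prod>j\<in>UNIV - {i}. (mat 1 :: real^'n^'n) $ j $ p j)))
        (at (mat 1 :: real^'n^'n))"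
      by (rule has_derivative_prod)
        (auto intro!: bounded_linear_imp_has_derivative bounded_linear_compose[OF bounded_linear_vec_nth bounded_linear_vec_nth])
    have eq: "of_int (sign p) * (\<Sum>i\<in>UNIV. E $ i $ p i * (\<Prod>j\<in>UNIV - {i}. (mat 1 :: real^'n^'n) $ j $ p j))
        = (if p = id then trace E else 0)" for E :: "real^'n^'n"
    proof (cases "p = id")
      case True
      then show ?thesis by (simp add: mat_def trace_def sign_id)
    next
      case False
      have zero: "(\<Prod>j\<in>UNIV - {i}. (mat 1 :: real^'n^'n) $ j $ p j) = 0" for i
      proof -
        from False obtain k where k: "p k \<noteq> k" by (auto simp: fun_eq_iff)
        \<comment> \<open>If \<open>p\<close> moves \<open>k\<close>, it also moves
          \<open>p k\<close>; one of these two indices differs from \<open>i\<close>.\<close>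
        have "\<exists>j. j \<noteq> i \<and> p j \<noteq> j"
        proof (cases "k = i")
          case True
          with k have "p k \<noteq> i" by auto
          moreover have "p (p k) \<noteq> p k" using k p by (metis permutes_inverses(2))
          ultimately show ?thesis by blast
        qed (use k in blast)
        then obtain j where "j \<noteq> i" "p j \<noteq> j" by blast
        then show ?thesis by (auto intro!: prod_zero bexI[of _ j] simp: mat_def)
      qed
      then show ?thesis
        using False by (simp only: zero mult_zero_right sum.neutral_const if_False)
    qed
    show ?thesis
      by (rule has_derivative_eq_rhs[OF has_derivative_mult_right[OF prod]]) (simp add: eq)
  qed
  have "(det has_derivative (\<lambda>E. \<Sum>p | p permutes (UNIV :: 'n set). if p = id then trace E else 0))
      (at (mat 1 :: real^'n^'n))"
    unfolding det_def by (intro has_derivative_sum summand) auto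
  moreover have "(\<Sum>p | p permutes (UNIV :: 'n set). if p = id then trace E else 0) = trace E"
    for E :: "real^'n^'n"
    by (simp add: permutes_id)
  ultimately show ?thesis by simp
qed

lemma matrix_inv_left_det:
  "det (A :: real^'n^'n) \<noteq> 0 \<Longrightarrow> matrix_inv A ** A = mat 1"
  and matrix_inv_right_det: "det A \<noteq> 0 \<Longrightarrow> A ** matrix_inv A = mat 1"
proof -
  assume "det A \<noteq> 0"
  then have "\<exists>B. A ** B = mat 1 \<and> B ** A = mat 1"
    by (simp add: invertible_det_nz flip: invertible_def)
  from someI_ex[OF this] show "matrix_inv A ** A = mat 1" "A ** matrix_inv A = mat 1"
    by (simp_all add: matrix_inv_def)
qed

text \<open>Jacobi's formula, transported from the identity matrix to \<open>G\<close> by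
  multiplicativity: det A = det G * det (G^-1 A).\<close>

lemma det_has_derivative:
  fixes G :: "real^'n^'n"
  assumes "det G \<noteq> 0"
  shows "(det has_derivative (\<lambda>E. det G * trace (matrix_inv G ** E))) (at G)"
proof -
  have lin: "((\<lambda>A. matrix_inv G ** A) has_derivative (\<lambda>E. matrix_inv G ** E)) (at G)"
    by (intro bounded_linear_imp_has_derivative
        bounded_bilinear.bounded_linear_right[OF bounded_bilinear_matrix_mult])
  have "(det has_derivative trace) (at (matrix_inv G ** G))"
    using det_has_derivative_mat_1 by (simp add: matrix_inv_left_det assms)
  from has_derivative_compose[OF lin this]
  have "((\<lambda>A. det G * det (matrix_inv G ** A)) has_derivative (\<lambda>E. det G * trace (matrix_inv G ** E))) (at G)"
    by (rule has_derivative_mult_right)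
  moreover have "det G * det (matrix_inv G ** A) = det A" for A
  proof -
    have "det G * det (matrix_inv G) = 1"
      by (metis assms det_I det_mul matrix_inv_right_det)
    then show ?thesis by (simp add: det_mul)
  qed
  ultimately show ?thesis by simp
qed

lemma continuous_det: "continuous_on S (det :: real^'n^'n \<Rightarrow> real)"
  unfolding det_def by (intro continuous_intros)

text \<open>Cramer's rule writes each entry of the inverse as a quotient of determinants, which is
  continuous. \<open>matrix_inv\<close> is a choice operator, so this formula holds only where the
  determinant is nonzero, hence eventually near \<open>G\<close>.\<close>

lemma matrix_inv_tendsto:
  fixes G :: "real^'n^'n"
  assumes "det G \<noteq> 0"
  shows "(matrix_inv \<longlongrightarrow> matrix_inv G) (at G)"
proof -
  let ?c = "\<lambda>i j A. det (\<chi> k l. if l = i then axis j 1 $ k else A $ k $ l) / det (A :: real^'n^'n)"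
  have entry: "matrix_inv A $ i $ j = ?c i j A" if "det A \<noteq> 0" for A :: "real^'n^'n" and i j
  proof -
    have "A *v column j (matrix_inv A) = axis j 1"
    proof -
      have "A *v column j (matrix_inv A) = column j (A ** matrix_inv A)"
        by (simp add: vec_eq_iff column_def matrix_vector_mult_def matrix_matrix_mult_def)
      also have "\<dots> = axis j 1"
        by (simp add: matrix_inv_right_det[OF that] vec_eq_iff column_def mat_def axis_def)
      finally show ?thesis .
    qed
    then have "column j (matrix_inv A) = (\<chi> k. det (\<chi> i l. if l = k then axis j 1 $ i else A $ i $ l) / det A)"
      using cramer[OF that] by blast
    then show ?thesis by (simp add: column_def vec_eq_iff)
  qed
  have "\<forall>\<^sub>F A in at G. det A \<noteq> 0"
    using continuous_det[of UNIV] assms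
    by (intro tendsto_imp_eventually_ne[of det "det G"])
      (auto simp: continuous_on_eq_continuous_at isCont_def)
  moreover have "(?c i j \<longlongrightarrow> ?c i j G) (at G)" for i j
  proof -
    have "((\<lambda>A. \<chi> k l. if l = i then axis j 1 $ k else A $ k $ l) \<longlongrightarrow>
        (\<chi> k l. if l = i then axis j 1 $ k else G $ k $ l)) (at G)"
      by (intro vec_tendstoI) (auto intro!: tendsto_intros)
    moreover have "isCont det A" for A :: "real^'n^'n"
      using continuous_det[of UNIV] by (auto simp: continuous_on_eq_continuous_at)
    ultimately show ?thesis
      using assms by (intro tendsto_divide isCont_tendsto_compose[of _ det])
        (auto simp: isCont_def)
  qed
  ultimately have "((\<lambda>A. matrix_inv A $ i $ j) \<longlongrightarrow> matrix_inv G $ i $ j) (at G)" for i j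
    by (subst entry[OF assms])
      (rule Lim_transform_eventually[of "?c i j"], auto elim!: eventually_mono simp: entry)
  then show ?thesis by (intro vec_tendstoI)
qed

text \<open>From A^-1 - G^-1 = - A^-1 (A - G) G^-1 the error of the linear approximation is - (A^-1
  - G^-1) (A - G) G^-1. It is o(|A - G|) because the inverse is continuous.\<close>

lemma matrix_inv_has_derivative:
  fixes G :: "real^'n^'n"
  assumes "det G \<noteq> 0"
  shows "(matrix_inv has_derivative (\<lambda>E. - (matrix_inv G ** E ** matrix_inv G))) (at G)"
proof -
  let ?I = "matrix_inv G"
  have "open {A :: real^'n^'n. det A \<noteq> 0}"
    by (intro open_Collect_neq continuous_det continuous_intros)
  then obtain e where e: "e > 0" "ball G e \<subseteq> {A. det A \<noteq> 0}"
    using assms openE by blast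
  have blin: "bounded_linear (\<lambda>E. - (?I ** E ** ?I))"
    by (intro bounded_linear_minus bounded_linear_compose[OF
          bounded_bilinear.bounded_linear_left[OF bounded_bilinear_matrix_mult]
          bounded_bilinear.bounded_linear_right[OF bounded_bilinear_matrix_mult]])
  obtain K where K: "K > 0"
    "norm (A ** B) \<le> norm A * norm B * K" for A B :: "real^'n^'n"
    using bounded_bilinear.pos_bounded[OF bounded_bilinear_matrix_mult] by blast
  let ?H = "\<lambda>A. norm (matrix_inv A - ?I) * (norm ?I * K) * K"
  have lim: "(?H \<longlongrightarrow> 0) (at G)"
    using tendsto_mult_left_zero[OF tendsto_mult_left_zero[OF
        tendsto_norm_zero[OF LIM_zero[OF matrix_inv_tendsto[OF assms]]]]] .
  have est: "norm (matrix_inv A - ?I - - (?I ** (A - G) ** ?I)) / norm (A - G) \<le> ?H A"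
    if "A \<noteq> G" "dist A G < e" for A
  proof -
    interpret m: bounded_bilinear "(**) :: real^'n^'n \<Rightarrow> real^'n^'n \<Rightarrow> real^'n^'n"
      by (rule bounded_bilinear_matrix_mult)
    have "det A \<noteq> 0" using subsetD[OF e(2), of A] that by (simp add: dist_commute)
    then have "matrix_inv A ** (A - G) ** ?I = ?I - matrix_inv A"
      by (simp add: m.diff_left m.diff_right matrix_inv_left_det matrix_inv_right_det assms
          flip: matrix_mul_assoc)
    then have "matrix_inv A - ?I - - (?I ** (A - G) ** ?I) = - ((matrix_inv A - ?I) ** ((A - G) ** ?I))"
      using m.diff_left[of "matrix_inv A" ?I "(A - G) ** ?I"]
      by (simp add: matrix_mul_assoc del: m.diff_left m.diff_right)
    also have "norm \<dots> \<le> norm (matrix_inv A - ?I) * norm ((A - G) ** ?I) * K"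
      using K by simp
    also have "\<dots> \<le> norm (matrix_inv A - ?I) * (norm (A - G) * norm ?I * K) * K"
      using K by (intro mult_left_mono mult_right_mono) auto
    finally show ?thesis
      using that by (simp add: field_simps)
  qed
  show ?thesis
    by (rule has_derivativeI_sandwich[OF e(1) blin _ lim]) (rule est)
qed

section \<open>The area density of a frame and its first two derivatives\<close>

definition gram :: "'a::euclidean_space^'n \<Rightarrow> real^'n^'n" where
  "gram X = (\<chi> i j. X $ i \<bullet> X $ j)"

definition symgram :: "'a::euclidean_space^'n \<Rightarrow> 'a^'n \<Rightarrow> real^'n^'n" where
  "symgram X Y = (\<chi> i j. X $ i \<bullet> Y $ j + Y $ i \<bullet> X $ j)"

text \<open>The action of matrices on frames. It expresses changes of frame, the raising of indices
  by the inverse metric, and rotations.\<close>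

definition row_comb :: "real^'n^'n \<Rightarrow> 'a::euclidean_space^'n \<Rightarrow> 'a^'n" where
  "row_comb A X = (\<chi> i. \<Sum>j\<in>UNIV. A $ i $ j *\<^sub>R X $ j)"

definition vol :: "'a::euclidean_space^'n \<Rightarrow> real" where
  "vol X = sqrt (det (gram X))"

text \<open>The gradient of \<open>vol\<close> for the inner product on frames. At
  \<open>X = jac F x\<close>, the vanishing of its divergence is the minimal surface system.\<close>

definition flux :: "'a::euclidean_space^'n \<Rightarrow> 'a^'n" where
  "flux X = vol X *\<^sub>R row_comb (matrix_inv (gram X)) X"

text \<open>The Hessian of \<open>vol\<close> as an operator on frames. The three terms come from
  differentiating the density, the inverse Gram matrix and the frame in \<open>flux\<close>.\<close>

definition flux_deriv :: "'a::euclidean_space^'n \<Rightarrow> 'a^'n \<Rightarrow> 'a^'n" where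
  "flux_deriv X Z =
     (let H = matrix_inv (gram X); S = symgram X Z in
      vol X *\<^sub>R ((trace (H ** S) / 2) *\<^sub>R row_comb H X - row_comb (H ** S ** H) X + row_comb H Z))"

lemma bounded_bilinear_symgram: "bounded_bilinear symgram"
  by (subst bilinear_conv_bounded_bilinear[symmetric])
    (auto simp: bilinear_def symgram_def vec_eq_iff inner_add inner_left_distrib algebra_simps
      intro!: linearI)

lemma bounded_bilinear_row_comb: "bounded_bilinear row_comb"
  by (subst bilinear_conv_bounded_bilinear[symmetric])
    (auto simp: bilinear_def row_comb_def vec_eq_iff sum.distrib scaleR_sum_right algebra_simps
      intro!: linearI)

lemma symgram_commute: "symgram X Y = symgram Y X"
  by (simp add: symgram_def vec_eq_iff)

lemma gram_eq_symgram: "gram X = (1/2) *\<^sub>R symgram X X"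
  by (simp add: symgram_def gram_def vec_eq_iff)

lemma transpose_gram [simp]: "transpose (gram X) = gram X"
  by (simp add: transpose_def gram_def vec_eq_iff inner_commute)

lemma transpose_symgram [simp]: "transpose (symgram X Y) = symgram X Y"
  by (simp add: transpose_def symgram_def vec_eq_iff inner_commute add.commute)

lemma transpose_matrix_inv_gram:
  assumes "det (gram X) \<noteq> 0"
  shows "transpose (matrix_inv (gram X)) = matrix_inv (gram X)"
proof -
  have "transpose (matrix_inv (gram X)) ** gram X = mat 1"
    by (metis assms matrix_inv_right_det matrix_transpose_mul transpose_gram transpose_mat)
  then show ?thesis
    by (metis assms matrix_inv_right_det matrix_mul_assoc matrix_mul_lid matrix_mul_rid)
qed

lemma gram_has_derivative: "(gram has_derivative symgram X) (at X)"
proof -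
  have "((\<lambda>X. (1/2) *\<^sub>R symgram X X) has_derivative
      (\<lambda>Z. (1/2) *\<^sub>R (symgram X Z + symgram Z X))) (at X)"
    by (intro derivative_intros bounded_bilinear.FDERIV[OF bounded_bilinear_symgram])
  moreover have "(1/2) *\<^sub>R (symgram X Z + symgram Z X) = symgram X Z" for Z
    by (simp add: symgram_commute[of Z] flip: scaleR_2)
  ultimately show ?thesis
    by (simp add: gram_eq_symgram[abs_def])
qed

text \<open>The two halves of the polarized Gram matrix contribute equally when \<open>A\<close> is
  symmetric. This converts the traces of Jacobi's formula into inner products of frames, from which
  gradients can be read off.\<close>

lemma trace_mult_symgram:
  assumes "transpose A = A"
  shows "trace (A ** symgram X Z) = 2 * (row_comb A X \<bullet> Z)"
proof -
  have sym: "A $ i $ j = A $ j $ i" for i j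
    using assms by (metis transpose_def vec_lambda_beta)
  have "trace (A ** symgram X Z)
      = (\<Sum>i\<in>UNIV. \<Sum>j\<in>UNIV. A $ i $ j * (X $ j \<bullet> Z $ i)) + (\<Sum>i\<in>UNIV. \<Sum>j\<in>UNIV. A $ i $ j * (Z $ j \<bullet> X $ i))"
    by (simp add: trace_def matrix_matrix_mult_def symgram_def sum.distrib algebra_simps)
  also have "(\<Sum>i\<in>UNIV. \<Sum>j\<in>UNIV. A $ i $ j * (Z $ j \<bullet> X $ i)) = (\<Sum>i\<in>UNIV. \<Sum>j\<in>UNIV. A $ i $ j * (X $ j \<bullet> Z $ i))"
    by (subst sum.swap) (metis (no_types, lifting) inner_commute sum.cong sym)
  finally show ?thesis
    by (simp add: inner_vec_def row_comb_def inner_sum_left)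
qed

lemma row_comb_inner_commute:
  assumes "transpose A = A"
  shows "row_comb A X \<bullet> Y = row_comb A Y \<bullet> X"
  using trace_mult_symgram[OF assms, of X Y] trace_mult_symgram[OF assms, of Y X]
  by (simp add: symgram_commute)

lemma row_comb_row_comb: "row_comb A (row_comb B X) = row_comb (A ** B) X"
proof -
  have "(\<Sum>j\<in>UNIV. \<Sum>k\<in>UNIV. (A $ i $ j * B $ j $ k) *\<^sub>R X $ k)
      = (\<Sum>k\<in>UNIV. \<Sum>j\<in>UNIV. (A $ i $ j * B $ j $ k) *\<^sub>R X $ k)" for i
    by (rule sum.swap)
  then show ?thesis
    by (simp add: row_comb_def vec_eq_iff matrix_matrix_mult_def scaleR_sum_right scaleR_sum_left)
qed

lemma vol_has_derivative:
  assumes "det (gram X) > 0"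
  shows "(vol has_derivative (\<lambda>Z. flux X \<bullet> Z)) (at X)"
proof -
  let ?H = "matrix_inv (gram X)"
  have "((\<lambda>X. det (gram X)) has_derivative (\<lambda>Z. det (gram X) * trace (?H ** symgram X Z))) (at X)"
    using has_derivative_compose[OF gram_has_derivative det_has_derivative] assms by force
  from has_derivative_real_sqrt[OF assms this]
  have "(vol has_derivative (\<lambda>Z. det (gram X) * trace (?H ** symgram X Z) / (2 * sqrt (det (gram X))))) (at X)"
    by (simp add: vol_def[abs_def] field_simps)
  moreover have "det (gram X) * trace (?H ** symgram X Z) / (2 * sqrt (det (gram X))) = flux X \<bullet> Z" for Z
  proof -
    have "det (gram X) = sqrt (det (gram X)) * sqrt (det (gram X))"
      using assms by simp
    moreover have "trace (?H ** symgram X Z) = 2 * (row_comb ?H X \<bullet> Z)"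
      using assms by (intro trace_mult_symgram transpose_matrix_inv_gram) auto
    ultimately show ?thesis
      using assms by (simp add: flux_def vol_def field_simps)
  qed
  ultimately show ?thesis by simp
qed

lemma vol_has_derivative_trace:
  assumes "det (gram X) > 0"
  shows "(vol has_derivative (\<lambda>Z. vol X * (trace (matrix_inv (gram X) ** symgram X Z) / 2))) (at X)"
  using vol_has_derivative[OF assms] assms
  by (simp add: trace_mult_symgram transpose_matrix_inv_gram flux_def)

lemma flux_has_derivative:
  fixes X :: "'a::euclidean_space^'n"
  assumes "det (gram X) > 0"
  shows "(flux has_derivative flux_deriv X) (at X)"
proof -
  let ?H = "matrix_inv (gram X)"
  have inv: "((\<lambda>X. matrix_inv (gram X)) has_derivative (\<lambda>Z. - (?H ** symgram X Z ** ?H))) (at X)"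
    using has_derivative_compose[OF gram_has_derivative matrix_inv_has_derivative] assms by force
  interpret r: bounded_bilinear "row_comb :: _ \<Rightarrow> 'a^'n \<Rightarrow> _" by (rule bounded_bilinear_row_comb)
  have "(flux has_derivative (\<lambda>Z. vol X *\<^sub>R (row_comb ?H Z + row_comb (- (?H ** symgram X Z ** ?H)) X)
      + (vol X * (trace (?H ** symgram X Z) / 2)) *\<^sub>R row_comb ?H X)) (at X)"
    unfolding flux_def[abs_def]
    by (intro has_derivative_scaleR vol_has_derivative_trace assms
        r.FDERIV[OF inv has_derivative_ident])
  moreover have "(\<lambda>Z. vol X *\<^sub>R (row_comb ?H Z + row_comb (- (?H ** symgram X Z ** ?H)) X)
      + (vol X * (trace (?H ** symgram X Z) / 2)) *\<^sub>R row_comb ?H X) = flux_deriv X"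
    by (simp add: fun_eq_iff flux_deriv_def Let_def r.minus_left algebra_simps)
  ultimately show ?thesis by simp
qed

lemma linear_flux_deriv: "linear (flux_deriv (X :: 'a::euclidean_space^'n))"
proof (rule linearI)
  interpret r: bounded_bilinear "row_comb :: _ \<Rightarrow> 'a^'n \<Rightarrow> _" by (rule bounded_bilinear_row_comb)
  interpret s: bounded_bilinear "symgram :: 'a^'n \<Rightarrow> _ \<Rightarrow> _" by (rule bounded_bilinear_symgram)
  interpret m: bounded_bilinear "(**) :: real^'n^'n \<Rightarrow> real^'n^'n \<Rightarrow> real^'n^'n"
    by (rule bounded_bilinear_matrix_mult)
  interpret t: bounded_linear "trace :: real^'n^'n \<Rightarrow> real" by (rule bounded_linear_trace)
  show "flux_deriv X (Z + Z') = flux_deriv X Z + flux_deriv X Z'" for Z Z'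
    by (simp add: flux_deriv_def Let_def r.add_right r.add_left s.add_right m.add_right m.add_left
        t.add algebra_simps add_divide_distrib)
  show "flux_deriv X (c *\<^sub>R Z) = c *\<^sub>R flux_deriv X Z" for c Z
    by (simp add: flux_deriv_def Let_def r.scaleR_right r.scaleR_left s.scaleR_right m.scaleR_right m.scaleR_left
        t.scaleR scaleR_add_right scaleR_diff_right ac_simps)
qed

text \<open>The Hessian as an explicit bilinear form. Its symmetry, its invariance under rotations
  and its sign are all obtained from this formula.\<close>

lemma flux_deriv_inner:
  assumes "det (gram X) \<noteq> 0"
  defines "H \<equiv> matrix_inv (gram X)"
  shows "flux_deriv X Z \<bullet> Y = vol X *
    (trace (H ** symgram X Z) * trace (H ** symgram X Y) / 4
     - trace (H ** symgram X Z ** (H ** symgram X Y)) / 2 + row_comb H Z \<bullet> Y)"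
proof -
  have H: "transpose H = H" unfolding H_def by (intro transpose_matrix_inv_gram assms)
  then have "transpose (H ** symgram X Z ** H) = H ** symgram X Z ** H"
    by (simp add: matrix_transpose_mul matrix_mul_assoc)
  from trace_mult_symgram[OF this, of X Y] trace_mult_symgram[OF H, of X Y] show ?thesis
    by (simp add: flux_deriv_def Let_def H_def[symmetric] inner_diff_left inner_add_left matrix_mul_assoc)
qed

lemma flux_deriv_symmetric:
  assumes "det (gram X) \<noteq> 0"
  shows "flux_deriv X Z \<bullet> Y = flux_deriv X Y \<bullet> Z"
  using row_comb_inner_commute[OF transpose_matrix_inv_gram[OF assms], of Z Y]
    trace_mul_sym[of "matrix_inv (gram X) ** symgram X Z" "matrix_inv (gram X) ** symgram X Y"]
  by (simp add: flux_deriv_inner[OF assms] mult.commute)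

text \<open>The derivative at \<open>B = I\<close> of the equivariance
  \<open>flux (row_comb B X) = det B *\<^sub>R row_comb (B\<^sup>-\<^sup>T) (flux X)\<close> for \<open>det B > 0\<close>.\<close>

lemma flux_deriv_row_comb:
  fixes X :: "'a::euclidean_space^'n"
  assumes "det (gram X) \<noteq> 0"
  shows "flux_deriv X (row_comb B X) = trace B *\<^sub>R flux X - row_comb (transpose B) (flux X)"
proof -
  let ?G = "gram X" and ?H = "matrix_inv (gram X)"
  interpret r: bounded_bilinear "row_comb :: _ \<Rightarrow> 'a^'n \<Rightarrow> _" by (rule bounded_bilinear_row_comb)
  \<comment> \<open>An infinitesimal change of frame \<open>B\<close> changes the Gram matrix by B G
    + G B^T. After multiplication by the inverse of \<open>G\<close>, one summand is just the
    transpose of \<open>B\<close>.\<close>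
  have S: "symgram X (row_comb B X) = ?G ** transpose B + B ** ?G"
    by (simp add: vec_eq_iff symgram_def row_comb_def gram_def matrix_matrix_mult_def transpose_def
        inner_sum_left inner_sum_right algebra_simps)
  have HS: "?H ** symgram X (row_comb B X) = transpose B + ?H ** B ** ?G"
    by (simp add: S matrix_add_ldistrib matrix_mul_assoc matrix_inv_left_det[OF assms])
  have "trace (?H ** B ** ?G) = trace B"
    by (subst trace_mul_sym) (simp add: matrix_mul_assoc matrix_inv_right_det[OF assms])
  moreover have "trace (transpose B) = trace B" by (simp add: trace_def transpose_def)
  ultimately have "trace (?H ** symgram X (row_comb B X)) = 2 * trace B"
    by (simp add: HS trace_add)
  moreover have "?H ** symgram X (row_comb B X) ** ?H = transpose B ** ?H + ?H ** B"
    by (simp add: HS bounded_bilinear.add_left[OF bounded_bilinear_matrix_mult] matrix_inv_right_det[OF assms] flip: matrix_mul_assoc)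
  ultimately show ?thesis
    by (simp add: flux_deriv_def Let_def flux_def row_comb_row_comb r.add_left r.scaleR_right algebra_simps)
qed

section \<open>Closure properties of smooth maps\<close>

lemma diff_times_on_cong:
  assumes "diff_times_on k S f" "open S" "\<And>x. x \<in> S \<Longrightarrow> f x = g x"
  shows "diff_times_on k S g"
  using assms(1,3)
proof (induction k arbitrary: f g)
  case 0
  then show ?case by (auto cong: continuous_on_cong)
next
  case (Suc k)
  have "frechet_derivative f (at x) = frechet_derivative g (at x)" if "x \<in> S" for x
    using Suc.prems that by (intro frechet_derivative_transform_within_open[OF _ \<open>open S\<close>]) auto
  moreover have "g differentiable at x" if "x \<in> S" for x
    using Suc.prems that \<open>open S\<close> unfolding differentiable_def diff_times_on.simps
    by (meson has_derivative_transform_within_open)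
  ultimately show ?case
    using Suc.prems(1) by (auto intro: Suc.IH)
qed

text \<open>Lets an explicit derivative \<open>f'\<close> replace \<open>frechet_derivative\<close>,
  so that each closure property becomes an induction on the order driven by its differentiation
  rule.\<close>

lemma diff_times_on_SucI:
  assumes "open S" "\<And>x. x \<in> S \<Longrightarrow> (f has_derivative f' x) (at x)"
    "\<And>v. diff_times_on k S (\<lambda>x. f' x v)"
  shows "diff_times_on (Suc k) S f"
proof -
  have "f' x = frechet_derivative f (at x)" if "x \<in> S" for x
    using assms(2)[OF that] by (rule frechet_derivative_at)
  then have "diff_times_on k S (\<lambda>x. frechet_derivative f (at x) v)" for v
    by (intro diff_times_on_cong[OF assms(3) assms(1)]) auto
  with assms(2) show ?thesis by (auto simp: differentiable_def)
qed

lemma diff_times_on_SucD: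
  assumes "diff_times_on (Suc k) S f"
  shows "x \<in> S \<Longrightarrow> (f has_derivative frechet_derivative f (at x)) (at x)"
    and "diff_times_on k S (\<lambda>x. frechet_derivative f (at x) v)"
  using assms by (auto simp: frechet_derivative_works)

lemma diff_times_on_lower: "diff_times_on (Suc k) S f \<Longrightarrow> diff_times_on k S f"
proof (induction k arbitrary: f)
  case 0
  then show ?case
    by (auto intro!: continuous_at_imp_continuous_on differentiable_imp_continuous_within)
next
  case (Suc k)
  then show ?case by (metis diff_times_on.simps(2))
qed

lemma diff_times_on_const: "diff_times_on k S (\<lambda>x. c)"
  by (induction k arbitrary: c) auto

lemma diff_times_on_ident:
  assumes "open S"
  shows "diff_times_on k S (\<lambda>x. x)"
proof (cases k)
  case (Suc l)
  show ?thesis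
    unfolding Suc
    by (rule diff_times_on_SucI[OF assms has_derivative_ident diff_times_on_const])
qed simp

lemma diff_times_on_bounded_linear_compose:
  assumes "bounded_linear L" "open S" "diff_times_on k S f"
  shows "diff_times_on k S (\<lambda>x. L (f x))"
  using assms(3)
proof (induction k arbitrary: f)
  case 0
  then show ?case
    using assms(1) by (auto intro: bounded_linear.continuous_on)
next
  case (Suc k)
  then show ?case
    by (intro diff_times_on_SucI[where f' = "\<lambda>x v. L (frechet_derivative f (at x) v)"] assms
        bounded_linear.has_derivative[OF assms(1)] Suc.IH diff_times_on_SucD[OF Suc.prems])
qed

lemma diff_times_on_add:
  assumes "open S" "diff_times_on k S f" "diff_times_on k S g"
  shows "diff_times_on k S (\<lambda>x. f x + g x)"
  using assms(2,3)
proof (induction k arbitrary: f g)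
  case 0
  then show ?case by (auto intro: continuous_intros)
next
  case (Suc k)
  then show ?case
    by (intro diff_times_on_SucI[where f' = "\<lambda>x v. frechet_derivative f (at x) v + frechet_derivative g (at x) v"]
        assms has_derivative_add Suc.IH diff_times_on_SucD[OF Suc.prems(1)]
        diff_times_on_SucD[OF Suc.prems(2)])
qed

lemma diff_times_on_bilinear:
  assumes b: "bounded_bilinear b" and "open S" "diff_times_on k S f" "diff_times_on k S g"
  shows "diff_times_on k S (\<lambda>x. b (f x) (g x))"
  using assms(3,4)
proof (induction k arbitrary: f g)
  case 0
  then show ?case by (auto intro: bounded_bilinear.continuous_on[OF b])
next
  case (Suc k)
  then show ?case
    by (intro diff_times_on_SucI[where f' =
          "\<lambda>x v. b (f x) (frechet_derivative g (at x) v) + b (frechet_derivative f (at x) v) (g x)"]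
        assms bounded_bilinear.FDERIV[OF b] diff_times_on_add Suc.IH
        diff_times_on_SucD[OF Suc.prems(1)] diff_times_on_SucD[OF Suc.prems(2)]
        diff_times_on_lower[OF Suc.prems(1)] diff_times_on_lower[OF Suc.prems(2)])
qed

lemma diff_times_on_sum:
  assumes "open S" "finite I" "\<And>i. i \<in> I \<Longrightarrow> diff_times_on k S (f i)"
  shows "diff_times_on k S (\<lambda>x. \<Sum>i\<in>I. f i x)"
  using assms(2,3) by (induction I) (auto intro!: diff_times_on_const diff_times_on_add assms(1))

text \<open>A vector is the sum of its components placed on the axes, and each \<open>axis i\<close>
  is bounded linear; this reduces the claim to sums and linear images.\<close>

lemma diff_times_on_vec_lambda:
  assumes "open S" "\<And>i. diff_times_on k S (f i)"
  shows "diff_times_on k S (\<lambda>x. \<chi> i. f i x)"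
proof -
  have "bounded_linear (axis i :: 'c::real_normed_vector \<Rightarrow> 'c^'b)" for i :: "'b::finite"
  proof (rule bounded_linear_intro[where K=1])
    show "norm (axis i x) \<le> norm x * 1" for x :: 'c
    proof -
      have "norm (axis i x) = sqrt (\<Sum>j\<in>UNIV. if j = i then (norm x)\<^sup>2 else 0)"
        unfolding norm_vec_def L2_set_def by (intro arg_cong[of _ _ sqrt] sum.cong) (auto simp: axis_def)
      then show ?thesis by simp
    qed
  qed (auto simp: axis_def vec_eq_iff)
  then have "diff_times_on k S (\<lambda>x. \<Sum>i\<in>UNIV. axis i (f i x))"
    by (intro diff_times_on_sum assms diff_times_on_bounded_linear_compose[where L = "axis i" for i]) auto
  moreover have "(\<Sum>i\<in>UNIV. axis i (f i x)) = (\<chi> i. f i x)" for x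
    by (simp add: vec_eq_iff axis_def if_distrib if_distribR cong: if_cong)
  ultimately show ?thesis by simp
qed

text \<open>The derivative of the inverse is a product of the inverse itself and the derivative of
  \<open>G\<close>, so regularity of order \<open>k\<close> of the inverse bootstraps to order
  \<open>k + 1\<close>.\<close>

lemma diff_times_on_matrix_inv:
  fixes G :: "'c::real_normed_vector \<Rightarrow> real^'n^'n"
  assumes "open S" "diff_times_on k S G" and det: "\<And>x. x \<in> S \<Longrightarrow> det (G x) \<noteq> 0"
  shows "diff_times_on k S (\<lambda>x. matrix_inv (G x))"
  using assms(2)
proof (induction k)
  case 0
  have "isCont matrix_inv (G x)" if "x \<in> S" for x
    using matrix_inv_tendsto[OF det[OF that]] by (simp add: isCont_def)
  then have "continuous_on (G ` S) matrix_inv"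
    by (auto intro: continuous_at_imp_continuous_on)
  from continuous_on_compose2[OF this] 0 show ?case by auto
next
  case (Suc k)
  have IH: "diff_times_on k S (\<lambda>x. matrix_inv (G x))"
    using Suc diff_times_on_lower by blast
  show ?case
  proof (rule diff_times_on_SucI[OF \<open>open S\<close>])
    show "((\<lambda>x. matrix_inv (G x)) has_derivative
        (\<lambda>v. - (matrix_inv (G x) ** frechet_derivative G (at x) v ** matrix_inv (G x)))) (at x)"
      if "x \<in> S" for x
      by (rule has_derivative_compose[OF diff_times_on_SucD(1)[OF Suc.prems that]
            matrix_inv_has_derivative[OF det[OF that]]])
    show "diff_times_on k S (\<lambda>x. - (matrix_inv (G x) ** frechet_derivative G (at x) v ** matrix_inv (G x)))" for v
      by (intro diff_times_on_bounded_linear_compose[of uminus] assms bounded_linear_minus bounded_linear_ident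
          diff_times_on_bilinear[OF bounded_bilinear_matrix_mult] IH diff_times_on_SucD[OF Suc.prems])
  qed
qed

lemma diff_times_on_gram:
  assumes "open S" "diff_times_on k S X"
  shows "diff_times_on k S (\<lambda>x. gram (X x))"
  unfolding gram_eq_symgram
  by (intro diff_times_on_bounded_linear_compose[of "\<lambda>A. (1/2) *\<^sub>R A"] bounded_linear_scaleR_right assms
      diff_times_on_bilinear[OF bounded_bilinear_symgram])

text \<open>The same bootstrap: in its trace form the derivative of \<open>vol\<close> has
  \<open>vol\<close> itself as a factor, and the other factor is already known to be
  regular.\<close>

lemma diff_times_on_vol:
  fixes X :: "'c::real_normed_vector \<Rightarrow> 'a::euclidean_space^'n"
  assumes "open S" "diff_times_on k S X" and det: "\<And>x. x \<in> S \<Longrightarrow> det (gram (X x)) > 0"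
  shows "diff_times_on k S (\<lambda>x. vol (X x))"
  using assms(2)
proof (induction k)
  case 0
  have "isCont vol (X x)" if "x \<in> S" for x
    using vol_has_derivative[OF det[OF that]] by (rule has_derivative_continuous)
  then have "continuous_on (X ` S) vol"
    by (auto intro: continuous_at_imp_continuous_on)
  from continuous_on_compose2[OF this] 0 show ?case by auto
next
  case (Suc k)
  have X: "diff_times_on k S X" using Suc diff_times_on_lower by blast
  have inv: "diff_times_on k S (\<lambda>x. matrix_inv (gram (X x)))"
    using det by (intro diff_times_on_matrix_inv diff_times_on_gram assms X) force
  show ?case
  proof (rule diff_times_on_SucI[OF \<open>open S\<close>])
    show "((\<lambda>x. vol (X x)) has_derivative (\<lambda>v. vol (X x) *
        (trace (matrix_inv (gram (X x)) ** symgram (X x) (frechet_derivative X (at x) v)) / 2))) (at x)"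
      if "x \<in> S" for x
      by (rule has_derivative_compose[OF diff_times_on_SucD(1)[OF Suc.prems that]
            vol_has_derivative_trace[OF det[OF that]]])
    show "diff_times_on k S (\<lambda>x. vol (X x) *
        (trace (matrix_inv (gram (X x)) ** symgram (X x) (frechet_derivative X (at x) v)) / 2))" for v
      by (intro diff_times_on_bilinear[OF bounded_bilinear_mult] assms
          Suc.IH X diff_times_on_bounded_linear_compose[OF bounded_linear_divide]
          diff_times_on_bounded_linear_compose[OF bounded_linear_trace]
          diff_times_on_bilinear[OF bounded_bilinear_matrix_mult] inv
          diff_times_on_bilinear[OF bounded_bilinear_symgram] diff_times_on_SucD[OF Suc.prems])
  qed
qed

lemma diff_times_on_flux:
  assumes "open S" "diff_times_on k S X" "\<And>x. x \<in> S \<Longrightarrow> det (gram (X x)) > 0"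
  shows "diff_times_on k S (\<lambda>x. flux (X x))"
  unfolding flux_def using assms(3)
  by (intro diff_times_on_bilinear[OF bounded_bilinear_scaleR] diff_times_on_vol assms
      diff_times_on_bilinear[OF bounded_bilinear_row_comb] diff_times_on_matrix_inv diff_times_on_gram) force+

lemma continuous_on_flux_deriv:
  fixes X Z :: "'c::topological_space \<Rightarrow> 'a::euclidean_space^'n"
  assumes X: "continuous_on S X" and Z: "continuous_on S Z" and det: "\<And>x. x \<in> S \<Longrightarrow> det (gram (X x)) > 0"
  shows "continuous_on S (\<lambda>x. flux_deriv (X x) (Z x))"
proof -
  have "isCont (\<lambda>X. matrix_inv (gram X)) (X x)" if "x \<in> S" for x
    using det[OF that] has_derivative_compose[OF gram_has_derivative matrix_inv_has_derivative, of "X x"]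
    by (intro has_derivative_continuous) auto
  then have "continuous_on (X ` S) (\<lambda>X. matrix_inv (gram X))"
    by (auto intro: continuous_at_imp_continuous_on)
  from continuous_on_compose2[OF this X] have inv: "continuous_on S (\<lambda>x. matrix_inv (gram (X x)))" by auto
  have "isCont vol (X x)" if "x \<in> S" for x
    using vol_has_derivative[OF det[OF that]] by (rule has_derivative_continuous)
  then have "continuous_on (X ` S) vol"
    by (auto intro: continuous_at_imp_continuous_on)
  from continuous_on_compose2[OF this X] have vol: "continuous_on S (\<lambda>x. vol (X x))" by auto
  show ?thesis
    unfolding flux_deriv_def Let_def
    by (intro bounded_bilinear.continuous_on[OF bounded_bilinear_scaleR] vol continuous_on_add continuous_on_diff
        bounded_bilinear.continuous_on[OF bounded_bilinear_row_comb] inv X Z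
        bounded_linear.continuous_on[OF bounded_linear_trace] bounded_linear.continuous_on[OF bounded_linear_divide]
        bounded_bilinear.continuous_on[OF bounded_bilinear_matrix_mult]
        bounded_bilinear.continuous_on[OF bounded_bilinear_symgram])
qed

section \<open>Symmetry of second derivatives, differentiation under the integral, divergence theorem\<close>

lemma has_real_derivative_along_line:
  assumes "(f has_derivative f') (at (c + s *\<^sub>R u))"
  shows "((\<lambda>s. f (c + s *\<^sub>R u)) has_real_derivative f' u) (at s)"
proof -
  have "((\<lambda>s. c + s *\<^sub>R u) has_derivative (\<lambda>h. h *\<^sub>R u)) (at s)"
    by (auto intro!: derivative_eq_intros)
  from has_derivative_compose[OF this assms] show ?thesis
    using linear_cmul[OF has_derivative_linear[OF assms]]
    by (simp add: has_field_derivative_def mult_commute_abs)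
qed

text \<open>Two applications of the mean value theorem: to the difference of \<open>f\<close> in
  direction \<open>v\<close> as a function of the step along \<open>u\<close>, then to the
  derivative along \<open>u\<close> as a function of the step along \<open>v\<close>.\<close>

lemma second_difference_mean_value:
  fixes f :: "'a::real_normed_vector \<Rightarrow> real"
  assumes f: "diff_times_on 2 S f" and t: "t > 0"
    and S: "\<And>s r. s \<in> {0..t} \<Longrightarrow> r \<in> {0..t} \<Longrightarrow> x + s *\<^sub>R u + r *\<^sub>R v \<in> S"
  shows "\<exists>s r. s \<in> {0<..<t} \<and> r \<in> {0<..<t} \<and>
    f (x + t *\<^sub>R u + t *\<^sub>R v) - f (x + t *\<^sub>R u) - f (x + t *\<^sub>R v) + f x
    = t\<^sup>2 * frechet_derivative (\<lambda>y. frechet_derivative f (at y) u) (at (x + s *\<^sub>R u + r *\<^sub>R v)) v"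
proof -
  have f': "(f has_derivative frechet_derivative f (at y)) (at y)" if "y \<in> S" for y
    using f that by (simp add: numeral_2_eq_2 flip: frechet_derivative_works)
  have f'': "((\<lambda>y. frechet_derivative f (at y) u) has_derivative
      frechet_derivative (\<lambda>y. frechet_derivative f (at y) u) (at y)) (at y)" if "y \<in> S" for y
    using f that by (simp add: numeral_2_eq_2 flip: frechet_derivative_works)
  let ?D = "\<lambda>y. frechet_derivative f (at y) u"
  let ?\<phi> = "\<lambda>s. f ((x + t *\<^sub>R v) + s *\<^sub>R u) - f (x + s *\<^sub>R u)"
  have "(?\<phi> has_real_derivative ?D ((x + t *\<^sub>R v) + s *\<^sub>R u) - ?D (x + s *\<^sub>R u)) (at s)"
    if "0 \<le> s" "s \<le> t" for s
    using S[of s t] S[of s 0] that t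
    by (intro DERIV_diff has_real_derivative_along_line f') (auto simp: algebra_simps)
  from MVT2[OF t this] obtain s where s: "0 < s" "s < t"
    "?\<phi> t - ?\<phi> 0 = t * (?D ((x + t *\<^sub>R v) + s *\<^sub>R u) - ?D (x + s *\<^sub>R u))" by auto
  have "((\<lambda>r. ?D ((x + s *\<^sub>R u) + r *\<^sub>R v)) has_real_derivative
      frechet_derivative ?D (at ((x + s *\<^sub>R u) + r *\<^sub>R v)) v) (at r)"
    if "0 \<le> r" "r \<le> t" for r
    using S[of s r] s that by (intro has_real_derivative_along_line f'') auto
  from MVT2[OF t this] obtain r where r: "0 < r" "r < t"
    "?D ((x + s *\<^sub>R u) + t *\<^sub>R v) - ?D ((x + s *\<^sub>R u) + 0 *\<^sub>R v)
     = t * frechet_derivative ?D (at ((x + s *\<^sub>R u) + r *\<^sub>R v)) v" by auto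
  have "?\<phi> t - ?\<phi> 0 = t\<^sup>2 * frechet_derivative ?D (at ((x + s *\<^sub>R u) + r *\<^sub>R v)) v"
    using s(3) r(3) by (simp add: algebra_simps power2_eq_square)
  then show ?thesis
    using s r by (intro exI[of _ s] exI[of _ r]) (auto simp: algebra_simps)
qed

text \<open>The second difference of \<open>f\<close> over a parallelogram is symmetric in its
  sides. Hence the two mixed derivatives agree at some pair of points arbitrarily close to
  \<open>x\<close>, and by continuity they agree at \<open>x\<close>.\<close>

lemma second_derivative_symmetric_real:
  fixes f :: "'a::real_normed_vector \<Rightarrow> real"
  assumes "open S" and f: "diff_times_on 2 S f" and x: "x \<in> S"
  shows "frechet_derivative (\<lambda>y. frechet_derivative f (at y) u) (at x) v
       = frechet_derivative (\<lambda>y. frechet_derivative f (at y) v) (at x) u"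
proof (rule ccontr)
  let ?A = "\<lambda>u v x. frechet_derivative (\<lambda>y. frechet_derivative f (at y) u) (at x) v"
  assume ne: "?A u v x \<noteq> ?A v u x"
  define e where "e = \<bar>?A u v x - ?A v u x\<bar> / 2"
  have "e > 0" using ne by (simp add: e_def)
  have cont: "isCont (?A u v) x" for u v
    using f x \<open>open S\<close> by (auto simp: numeral_2_eq_2 continuous_on_eq_continuous_at)
  obtain d1 where d1: "d1 > 0" "\<And>y. dist y x < d1 \<Longrightarrow> dist (?A u v y) (?A u v x) < e"
    using cont[of u v] \<open>e > 0\<close> unfolding continuous_at_eps_delta by metis
  obtain d2 where d2: "d2 > 0" "\<And>y. dist y x < d2 \<Longrightarrow> dist (?A v u y) (?A v u x) < e"
    using cont[of v u] \<open>e > 0\<close> unfolding continuous_at_eps_delta by metis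
  obtain d3 where d3: "d3 > 0" "ball x d3 \<subseteq> S"
    using x \<open>open S\<close> openE by blast
  define d where "d = min d1 (min d2 d3)"
  have "d > 0" using d1 d2 d3 by (simp add: d_def)
  \<comment> \<open>The parallelogram with sides \<open>t u\<close> and \<open>t v\<close> then lies
    within distance \<open>d\<close> of \<open>x\<close>; the summand 1 keeps the denominator
    positive and the inequality strict.\<close>
  define t where "t = d / (norm u + norm v + 1)"
  have t: "t > 0" using \<open>d > 0\<close> by (simp add: t_def add_nonneg_pos)
  have near: "dist (x + s *\<^sub>R u + r *\<^sub>R v) x < d" if "s \<in> {0..t}" "r \<in> {0..t}" for s r
  proof -
    have "norm (s *\<^sub>R u + r *\<^sub>R v) \<le> t * norm u + t * norm v"
      using that by (intro norm_triangle_le add_mono) (auto intro: mult_right_mono)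
    also have "\<dots> < t * (norm u + norm v + 1)" using t by (simp add: algebra_simps)
    also have "\<dots> = d" unfolding t_def by (simp add: add_nonneg_pos less_imp_neq[symmetric])
    finally show ?thesis by (simp add: dist_norm add.assoc)
  qed
  have near': "dist (x + s *\<^sub>R v + r *\<^sub>R u) x < d" if "s \<in> {0..t}" "r \<in> {0..t}" for s r
    using near[of r s] that by (simp add: algebra_simps)
  have "x + s *\<^sub>R u + r *\<^sub>R v \<in> S" "x + s *\<^sub>R v + r *\<^sub>R u \<in> S" if "s \<in> {0..t}" "r \<in> {0..t}" for s r
    using near[OF that] near'[OF that] d3(2) by (auto simp: d_def dist_commute subset_iff)
  note in_S = this
  obtain s r where sr: "s \<in> {0<..<t}" "r \<in> {0<..<t}"
    "f (x + t *\<^sub>R u + t *\<^sub>R v) - f (x + t *\<^sub>R u) - f (x + t *\<^sub>R v) + f x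
      = t\<^sup>2 * ?A u v (x + s *\<^sub>R u + r *\<^sub>R v)"
    using second_difference_mean_value[OF f t in_S(1)] by blast
  obtain s' r' where sr': "s' \<in> {0<..<t}" "r' \<in> {0<..<t}"
    "f (x + t *\<^sub>R v + t *\<^sub>R u) - f (x + t *\<^sub>R v) - f (x + t *\<^sub>R u) + f x
      = t\<^sup>2 * ?A v u (x + s' *\<^sub>R v + r' *\<^sub>R u)"
    using second_difference_mean_value[OF f t in_S(2)] by blast
  have "t\<^sup>2 * ?A u v (x + s *\<^sub>R u + r *\<^sub>R v) = t\<^sup>2 * ?A v u (x + s' *\<^sub>R v + r' *\<^sub>R u)"
    unfolding sr(3)[symmetric] sr'(3)[symmetric] by (simp add: algebra_simps)
  then have eq: "?A u v (x + s *\<^sub>R u + r *\<^sub>R v) = ?A v u (x + s' *\<^sub>R v + r' *\<^sub>R u)"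
    using t by simp
  have "dist (?A u v (x + s *\<^sub>R u + r *\<^sub>R v)) (?A u v x) < e"
    using near[of s r] sr(1,2) by (intro d1(2)) (auto simp: d_def)
  moreover have "dist (?A v u (x + s' *\<^sub>R v + r' *\<^sub>R u)) (?A v u x) < e"
    using near'[of s' r'] sr'(1,2) by (intro d2(2)) (auto simp: d_def)
  moreover have "dist (?A u v x) (?A v u x)
      \<le> dist (?A u v (x + s *\<^sub>R u + r *\<^sub>R v)) (?A u v x) + dist (?A u v (x + s *\<^sub>R u + r *\<^sub>R v)) (?A v u x)"
    by (rule dist_triangle3)
  ultimately have "dist (?A u v x) (?A v u x) < e + e"
    unfolding eq by linarith
  then show False by (simp add: dist_real_def e_def)
qed

lemma frechet_derivative_inner_left:
  assumes "f differentiable at x"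
  shows "frechet_derivative (\<lambda>x. f x \<bullet> b) (at x) v = frechet_derivative f (at x) v \<bullet> b"
  using frechet_derivative_at[OF has_derivative_inner_left[OF assms[unfolded frechet_derivative_works], of b]]
  by metis

lemma second_derivative_symmetric:
  fixes f :: "'a::real_normed_vector \<Rightarrow> 'b::real_inner"
  assumes "open S" and f: "diff_times_on 2 S f" and x: "x \<in> S"
  shows "frechet_derivative (\<lambda>y. frechet_derivative f (at y) u) (at x) v
       = frechet_derivative (\<lambda>y. frechet_derivative f (at y) v) (at x) u"
proof (rule vector_eq_rdot[THEN iffD1], rule allI)
  fix b :: 'b
  have comp: "frechet_derivative (\<lambda>y. frechet_derivative (\<lambda>x. f x \<bullet> b) (at y) w) (at x) w'
      = frechet_derivative (\<lambda>y. frechet_derivative f (at y) w) (at x) w' \<bullet> b" for w w'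
  proof -
    have "(\<lambda>y. frechet_derivative f (at y) w) differentiable at x"
      using f x by (simp add: numeral_2_eq_2)
    moreover have "frechet_derivative (\<lambda>y. frechet_derivative (\<lambda>x. f x \<bullet> b) (at y) w) (at x)
        = frechet_derivative (\<lambda>y. frechet_derivative f (at y) w \<bullet> b) (at x)"
    proof (rule sym, rule frechet_derivative_transform_within_open[OF _ \<open>open S\<close> x])
      show "(\<lambda>y. frechet_derivative f (at y) w \<bullet> b) differentiable at x"
        using f x by (intro differentiable_inner) (auto simp: numeral_2_eq_2)
      show "frechet_derivative f (at y) w \<bullet> b = frechet_derivative (\<lambda>x. f x \<bullet> b) (at y) w" if "y \<in> S" for y
        using f that by (intro frechet_derivative_inner_left[symmetric]) (auto simp: numeral_2_eq_2)
    qed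
    ultimately show ?thesis by (simp add: frechet_derivative_inner_left)
  qed
  have "diff_times_on 2 S (\<lambda>x. f x \<bullet> b)"
    by (intro diff_times_on_bounded_linear_compose[OF bounded_linear_inner_left] assms)
  from second_derivative_symmetric_real[OF \<open>open S\<close> this x, of u v]
  show "frechet_derivative (\<lambda>y. frechet_derivative f (at y) u) (at x) v \<bullet> b
       = frechet_derivative (\<lambda>y. frechet_derivative f (at y) v) (at x) u \<bullet> b"
    by (simp add: comp)
qed

text \<open>Uniform continuity of \<open>\<phi>'\<close> on the compact product bounds the remainder
  of the linear approximation by \<open>e' * |t - t0|\<close> simultaneously for all
  \<open>x\<close> in \<open>K\<close>, so the bound can be integrated.\<close>

lemma set_integral_compact_has_real_derivative:
  fixes \<phi> \<phi>' :: "real \<Rightarrow> 'a::euclidean_space \<Rightarrow> real"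
  assumes K: "compact K" and t0: "t0 \<in> {a<..<b}"
    and der: "\<And>t x. t \<in> {a..b} \<Longrightarrow> x \<in> K \<Longrightarrow> ((\<lambda>t. \<phi> t x) has_real_derivative \<phi>' t x) (at t)"
    and cont: "\<And>t. t \<in> {a..b} \<Longrightarrow> continuous_on K (\<phi> t)"
    and cont': "continuous_on ({a..b} \<times> K) (\<lambda>(t, x). \<phi>' t x)"
  shows "((\<lambda>t. LINT x:K|lborel. \<phi> t x) has_real_derivative (LINT x:K|lborel. \<phi>' t0 x)) (at t0)"
proof -
  have int: "set_integrable lborel K g" if "continuous_on K g" for g :: "'a \<Rightarrow> real"
    unfolding set_integrable_def by (rule borel_integrable_compact[OF K that])
  have c': "continuous_on K (\<phi>' t)" if "t \<in> {a..b}" for t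
  proof -
    have "continuous_on K (\<lambda>x. case (t, x) of (t, x) \<Rightarrow> \<phi>' t x)"
      by (rule continuous_on_compose2[OF cont']) (use that in \<open>auto intro!: continuous_intros\<close>)
    then show ?thesis by simp
  qed
  show ?thesis
    unfolding has_field_derivative_def has_derivative_at_alt
  proof (intro conjI bounded_linear_mult_right allI impI)
    fix e :: real assume "e > 0"
    define m where "m = measure lborel K"
    \<comment> \<open>Ensures \<open>m * e' \<le> e\<close> even if \<open>K\<close> is a null
      set.\<close>
    define e' where "e' = e / (m + 1)"
    have "m \<ge> 0" by (simp add: m_def)
    have "e' > 0" using \<open>e > 0\<close> \<open>m \<ge> 0\<close> by (simp add: e'_def)
    have "uniformly_continuous_on ({a..b} \<times> K) (\<lambda>(t, x). \<phi>' t x)"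
      by (intro compact_uniformly_continuous cont' compact_Times K) auto
    from uniformly_continuous_onE[OF this \<open>e' > 0\<close>] obtain d where d: "d > 0"
      "\<And>p q. p \<in> {a..b} \<times> K \<Longrightarrow> q \<in> {a..b} \<times> K \<Longrightarrow> dist q p < d \<Longrightarrow>
        dist (case q of (t, x) \<Rightarrow> \<phi>' t x) (case p of (t, x) \<Rightarrow> \<phi>' t x) < e'"
      by metis
    define d' where "d' = min d (min (t0 - a) (b - t0))"
    show "\<exists>d>0. \<forall>t. norm (t - t0) < d \<longrightarrow>
      norm ((LINT x:K|lborel. \<phi> t x) - (LINT x:K|lborel. \<phi> t0 x) - (LINT x:K|lborel. \<phi>' t0 x) * (t - t0))
        \<le> e * norm (t - t0)"
    proof (intro exI[of _ d'] conjI allI impI)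
      show "d' > 0" using t0 d(1) by (simp add: d'_def)
      fix t assume t: "norm (t - t0) < d'"
      have tab: "t \<in> {a..b}" "t0 \<in> {a..b}" using t t0 by (auto simp: d'_def)
      let ?r = "\<lambda>x. \<phi> t x - \<phi> t0 x - \<phi>' t0 x * (t - t0)"
      have r: "\<bar>?r x\<bar> \<le> e' * \<bar>t - t0\<bar>" if "x \<in> K" for x
      proof -
        let ?I = "closed_segment t0 t"
        have I: "?I \<subseteq> {a..b}"
          using tab by (intro closed_segment_subset) auto
        \<comment> \<open>Mean value inequality for \<open>\<phi> s x\<close> minus its linear part,
          whose derivative in \<open>s\<close> is the small difference
          \<open>\<phi>' s x - \<phi>' t0 x\<close>.\<close>
        have "norm ((\<phi> t x - t * \<phi>' t0 x) - (\<phi> t0 x - t0 * \<phi>' t0 x)) \<le> e' * norm (t - t0)"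
        proof (rule field_differentiable_bound[where S = "?I" and f = "\<lambda>s. \<phi> s x - s * \<phi>' t0 x" and f' = "\<lambda>s. \<phi>' s x - \<phi>' t0 x"])
          show "((\<lambda>s. \<phi> s x - s * \<phi>' t0 x) has_real_derivative \<phi>' s x - \<phi>' t0 x) (at s within ?I)"
            if "s \<in> ?I" for s
            using I that \<open>x \<in> K\<close>
            by (auto intro!: derivative_eq_intros has_field_derivative_at_within[OF der])
          show "norm (\<phi>' s x - \<phi>' t0 x) \<le> e'" if "s \<in> ?I" for s
          proof -
            have "\<bar>s - t0\<bar> \<le> \<bar>t - t0\<bar>"
              using that by (auto simp: closed_segment_eq_real_ivl split: if_splits)
            then show ?thesis
              using d(2)[of "(t0, x)" "(s, x)"] that I tab \<open>x \<in> K\<close> t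
              by (auto simp: dist_real_def dist_Pair_Pair d'_def)
          qed
        qed auto
        then show ?thesis by (simp add: algebra_simps)
      qed
      have cr: "continuous_on K ?r"
        using cont[OF tab(1)] cont[OF tab(2)] c'[OF tab(2)] by (intro continuous_intros)
      have "(LINT x:K|lborel. \<phi> t x) - (LINT x:K|lborel. \<phi> t0 x) - (LINT x:K|lborel. \<phi>' t0 x) * (t - t0)
          = (LINT x:K|lborel. ?r x)"
        using int[OF cont[OF tab(1)]] int[OF cont[OF tab(2)]] int[OF c'[OF tab(2)]]
        by (simp add: set_integral_diff)
      also have "norm \<dots> \<le> (LINT x:K|lborel. \<bar>?r x\<bar>)"
        using set_integral_norm_bound[OF int[OF cr]] by simp
      also have "\<dots> \<le> (LINT x:K|lborel. e' * \<bar>t - t0\<bar>)"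
        using r by (intro set_integral_mono int continuous_intros cr) auto
      also have "\<dots> = m * (e' * \<bar>t - t0\<bar>)"
        using K by (simp add: m_def set_lebesgue_integral_def fmeasurable_compact)
      also have "\<dots> \<le> e * norm (t - t0)"
      proof -
        have "m * e' \<le> e"
          using \<open>e > 0\<close> \<open>m \<ge> 0\<close> by (simp add: e'_def field_simps)
        then show ?thesis
          using mult_right_mono[of "m * e'" e "\<bar>t - t0\<bar>"] by (simp add: mult.assoc)
      qed
      finally show "norm ((LINT x:K|lborel. \<phi> t x) - (LINT x:K|lborel. \<phi> t0 x) - (LINT x:K|lborel. \<phi>' t0 x) * (t - t0))
        \<le> e * norm (t - t0)" .
    qed
  qed
qed

section \<open>The divergence theorem for compact support\<close>

lemma frechet_derivative_eq_0_off:
  assumes "open D" "closed K" "\<And>x. x \<in> D - K \<Longrightarrow> h x = 0" "x \<in> D - K"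
  shows "frechet_derivative h (at x) v = 0"
proof -
  have "(h has_derivative (\<lambda>_. 0)) (at x)"
    by (rule has_derivative_transform_within_open[where f = "\<lambda>_. 0" and s = "D - K"])
      (use assms in auto)
  then show ?thesis by (metis frechet_derivative_at)
qed

text \<open>By translation invariance of Lebesgue measure the integral of \<open>h (x + s v)\<close>
  does not depend on \<open>s\<close>; differentiating at \<open>s = 0\<close> under the integral
  gives the claim, with no regularity of the boundary of \<open>K\<close>.\<close>

lemma integral_compact_support_derivative_eq_0:
  fixes h :: "'a::euclidean_space \<Rightarrow> real"
  assumes "open D" and h: "diff_times_on 1 D h" and K: "compact K" "K \<subseteq> D"
    and h0: "\<And>x. x \<in> D - K \<Longrightarrow> h x = 0"
  shows "(LINT x:K|lborel. frechet_derivative h (at x) v) = 0"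
proof -
  \<comment> \<open>Extensions by zero to the whole space, needed because translates leave
    \<open>D\<close>. They inherit the regularity of \<open>h\<close> since \<open>h\<close>
    vanishes on \<open>D - K\<close> and the open sets \<open>D\<close> and \<open>- K\<close> cover
    the space.\<close>
  define k where "k x = (if x \<in> K then h x else 0)" for x
  define g where "g x = (if x \<in> K then frechet_derivative h (at x) v else 0)" for x
  have "closed K" using K(1) by (rule compact_imp_closed)
  have g_off: "g x = frechet_derivative h (at x) v" if "x \<in> D" for x
    using that frechet_derivative_eq_0_off[OF \<open>open D\<close> \<open>closed K\<close> h0] by (auto simp: g_def)
  have "continuous_on (D \<union> - K) g"
  proof (rule continuous_on_open_Un)
    have "continuous_on D (\<lambda>x. frechet_derivative h (at x) v)" using h by simp
    then show "continuous_on D g" using g_off by (auto cong: continuous_on_cong)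
    show "continuous_on (- K) g" by (rule continuous_on_eq[of _ "\<lambda>_. 0"]) (auto simp: g_def)
  qed (use \<open>open D\<close> \<open>closed K\<close> in auto)
  moreover have "D \<union> - K = UNIV" using K by auto
  ultimately have g: "continuous_on UNIV g" by simp
  have k': "((\<lambda>s. k (x + s *\<^sub>R v)) has_real_derivative g (x + s *\<^sub>R v)) (at s)" for x s
  proof (cases "x + s *\<^sub>R v \<in> D")
    case True
    then have "(h has_derivative frechet_derivative h (at (x + s *\<^sub>R v))) (at (x + s *\<^sub>R v))"
      using h diff_times_on_SucD(1)[of 0 D h] by simp
    then have "(k has_derivative frechet_derivative h (at (x + s *\<^sub>R v))) (at (x + s *\<^sub>R v))"
      by (rule has_derivative_transform_within_open[OF _ \<open>open D\<close> True]) (auto simp: k_def h0)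
    from has_real_derivative_along_line[OF this] show ?thesis by (simp add: g_off True)
  next
    case False
    have "(k has_derivative (\<lambda>_. 0)) (at (x + s *\<^sub>R v))"
      by (rule has_derivative_transform_within_open[where f = "\<lambda>_. 0" and s = "- K"])
        (use False K \<open>closed K\<close> in \<open>auto simp: k_def\<close>)
    from has_real_derivative_along_line[OF this] show ?thesis using False K by (auto simp: g_def)
  qed
  have k_cont: "continuous_on UNIV k"
  proof -
    have "continuous_on (D \<union> - K) k"
    proof (rule continuous_on_open_Un)
      have "continuous_on D h" using h diff_times_on_lower[of 0 D h] by simp
      then show "continuous_on D k"
        by (rule continuous_on_eq) (auto simp: k_def h0)
      show "continuous_on (- K) k" by (rule continuous_on_eq[of _ "\<lambda>_. 0"]) (auto simp: k_def)
    qed (use \<open>open D\<close> \<open>closed K\<close> in auto)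
    then show ?thesis using \<open>D \<union> - K = UNIV\<close> by simp
  qed
  \<comment> \<open>A single compact set containing the supports of all translates with |s| <= 1.
    The interval is symmetric, so the sign of the shift does not matter.\<close>
  define L where "L = (\<lambda>(s, x). x + s *\<^sub>R v) ` ({-1..1} \<times> K)"
  have "compact L"
    unfolding L_def case_prod_unfold
    by (intro compact_continuous_image compact_Times K continuous_intros) auto
  have "K \<subseteq> L"
  proof
    fix x assume "x \<in> K"
    then have "x + 0 *\<^sub>R v \<in> L"
      unfolding L_def by (intro image_eqI[of _ _ "(0, x)"]) auto
    then show "x \<in> L" by simp
  qed
  have off: "x + s *\<^sub>R v \<notin> K" if "s \<in> {-1..1}" "x \<notin> L" for x s
  proof
    assume "x + s *\<^sub>R v \<in> K"
    then have "(x + s *\<^sub>R v) + (- s) *\<^sub>R v \<in> L"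
      unfolding L_def using that(1) by (intro image_eqI[of _ _ "(- s, x + s *\<^sub>R v)"]) auto
    with that show False by simp
  qed
  have der: "((\<lambda>s. LINT x:L|lborel. k (x + s *\<^sub>R v)) has_real_derivative (LINT x:L|lborel. g (x + 0 *\<^sub>R v))) (at 0)"
  proof (rule set_integral_compact_has_real_derivative[where a = "-1" and b = 1])
    show "continuous_on ({-1..1} \<times> L) (\<lambda>(t, x). g (x + t *\<^sub>R v))"
      unfolding case_prod_unfold
      by (rule continuous_on_compose2[OF g]) (auto intro!: continuous_intros)
    show "continuous_on L (\<lambda>x. k (x + t *\<^sub>R v))" for t
      by (rule continuous_on_compose2[OF k_cont]) (auto intro!: continuous_intros)
  qed (use \<open>compact L\<close> k' in auto)
  have const: "(LINT x:L|lborel. k (x + s *\<^sub>R v)) = (\<integral>x. k x \<partial>lborel)" if "s \<in> {-1<..<1}" for s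
  proof -
    have "(LINT x:L|lborel. k (x + s *\<^sub>R v)) = (\<integral>x. k (s *\<^sub>R v + x) \<partial>lborel)"
      unfolding set_lebesgue_integral_def using off[of s] that
      by (intro Bochner_Integration.integral_cong) (auto simp: indicator_def k_def add.commute)
    also have "\<dots> = (\<integral>x. k x \<partial>distr lborel borel ((+) (s *\<^sub>R v)))"
      using k_cont by (subst integral_distr) (auto intro: borel_measurable_continuous_onI)
    finally show ?thesis by (simp add: lborel_distr_plus)
  qed
  have "((\<lambda>s. \<integral>x. k x \<partial>lborel) has_real_derivative (LINT x:L|lborel. g x)) (at 0)"
    by (rule has_field_derivative_transform_within_open[where S = "{-1<..<1}"
          and f = "\<lambda>s. LINT x:L|lborel. k (x + s *\<^sub>R v)"])
      (use der const in auto)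
  then have "(LINT x:L|lborel. g x) = 0"
    using DERIV_const DERIV_unique by blast
  moreover have "(LINT x:L|lborel. g x) = (LINT x:K|lborel. frechet_derivative h (at x) v)"
    unfolding set_lebesgue_integral_def using \<open>K \<subseteq> L\<close>
    by (intro Bochner_Integration.integral_cong) (auto simp: indicator_def g_def)
  ultimately show ?thesis by simp
qed

section \<open>Convexity of the area integrand\<close>

lemma self_adjoint_maximizer_is_eigenvector:
  fixes f :: "'a::euclidean_space \<Rightarrow> 'a"
  assumes f: "linear f" and sa: "\<And>x y. f x \<bullet> y = x \<bullet> f y"
    and S: "subspace S" "f ` S \<subseteq> S" and e: "e \<in> S" "norm e = 1"
    and max: "\<And>x. x \<in> S \<Longrightarrow> f x \<bullet> x \<le> (f e \<bullet> e) * (x \<bullet> x)"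
  shows "f e = (f e \<bullet> e) *\<^sub>R e"
proof -
  define M where "M = f e \<bullet> e"
  define v where "v = f e - M *\<^sub>R e"
  have ee: "e \<bullet> e = 1" using e by (simp add: dot_square_norm)
  have "v \<in> S"
    unfolding v_def using S e by (intro subspace_diff subspace_scale) auto
  have ev: "e \<bullet> v = 0" by (simp add: v_def inner_diff_right ee M_def inner_commute)
  have fev: "f e \<bullet> v = v \<bullet> v"
    using ev by (simp add: v_def inner_diff_left inner_diff_right inner_commute)
  \<comment> \<open>\<open>v\<close> is the part of \<open>f e\<close> orthogonal to
    \<open>e\<close>. Testing maximality at \<open>e + t v\<close> bounds a term linear in
    \<open>t\<close> by a quadratic one, which forces \<open>v\<close> to vanish.\<close>
  have quad: "2 * t * (v \<bullet> v) \<le> t\<^sup>2 * (M * (v \<bullet> v) - f v \<bullet> v)" for t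
  proof -
    have "e + t *\<^sub>R v \<in> S" using S e \<open>v \<in> S\<close> by (intro subspace_add subspace_scale)
    note max = max[OF this]
    have e1: "f (e + t *\<^sub>R v) \<bullet> (e + t *\<^sub>R v) = M + 2 * t * (v \<bullet> v) + t\<^sup>2 * (f v \<bullet> v)"
    proof -
      have "f v \<bullet> e = v \<bullet> v" using sa[of v e] fev inner_commute[of v "f e"] by simp
      then show ?thesis
        using fev f by (simp add: linear_add linear_cmul inner_add_left inner_add_right M_def power2_eq_square)
    qed
    have e2: "(e + t *\<^sub>R v) \<bullet> (e + t *\<^sub>R v) = 1 + t\<^sup>2 * (v \<bullet> v)"
      using ev inner_commute[of v e] by (simp add: inner_add_left inner_add_right ee power2_eq_square)
    have "M + 2 * t * (v \<bullet> v) + t\<^sup>2 * (f v \<bullet> v) \<le> M * (1 + t\<^sup>2 * (v \<bullet> v))"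
      using max by (simp only: e1 e2 flip: M_def)
    then show ?thesis by (simp add: algebra_simps)
  qed
  have "v \<bullet> v = 0"
  proof (rule ccontr)
    assume ne: "v \<bullet> v \<noteq> 0"
    define c where "c = \<bar>M * (v \<bullet> v) - f v \<bullet> v\<bar> + 1"
    \<comment> \<open>Chosen so that \<open>t * c = v \<bullet> v\<close>; the estimate then reads
      \<open>2 * (v \<bullet> v) \<le> v \<bullet> v\<close>, which is absurd.\<close>
    define t where "t = (v \<bullet> v) / c"
    have pos: "v \<bullet> v > 0" "c > 0" using ne by (auto simp: c_def add_nonneg_pos)
    then have "t > 0" by (simp add: t_def)
    have "2 * t * (v \<bullet> v) \<le> t\<^sup>2 * c"
      using quad[of t] by (rule order_trans) (auto simp: c_def intro!: mult_left_mono)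
    then have "2 * (v \<bullet> v) \<le> t * c"
      using \<open>t > 0\<close> by (simp add: power2_eq_square mult.assoc)
    then show False using pos by (simp add: t_def)
  qed
  then show ?thesis by (simp add: v_def M_def)
qed

text \<open>Induction on the dimension: a maximizer of the Rayleigh quotient on the unit sphere of
  \<open>S\<close> is an eigenvector, and self-adjointness makes its orthogonal complement in
  \<open>S\<close> invariant again.\<close>

lemma orthonormal_eigenbasis_subspace:
  fixes f :: "'a::euclidean_space \<Rightarrow> 'a"
  assumes f: "linear f" and sa: "\<And>x y. f x \<bullet> y = x \<bullet> f y"
    and "subspace S" "f ` S \<subseteq> S"
  shows "\<exists>B. B \<subseteq> S \<and> span B = S \<and> pairwise orthogonal B \<and> (\<forall>b\<in>B. norm b = 1 \<and> (\<exists>c. f b = c *\<^sub>R b))"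
  using assms(3,4)
proof (induction "dim S" arbitrary: S rule: less_induct)
  case less
  show ?case
  proof (cases "S = {0}")
    case True
    then show ?thesis by (intro exI[of _ "{}"]) auto
  next
    case False
    then obtain y where y: "y \<in> S" "y \<noteq> 0" using less.prems subspace_0 by blast
    let ?C = "sphere 0 1 \<inter> S"
    have "compact ?C"
      by (intro compact_Int_closed closed_subspace less.prems) auto
    moreover have "y /\<^sub>R norm y \<in> ?C" using y less.prems by (auto intro: subspace_scale)
    moreover have "continuous_on ?C (\<lambda>x. f x \<bullet> x)"
      by (intro continuous_intros linear_continuous_on) (simp add: f linear_linear)
    ultimately obtain e where e: "e \<in> ?C" "\<And>x. x \<in> ?C \<Longrightarrow> f x \<bullet> x \<le> f e \<bullet> e"
      using continuous_attains_sup[of ?C] by blast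
    have eS: "e \<in> S" "norm e = 1" using e by auto
    have "f x \<bullet> x \<le> (f e \<bullet> e) * (x \<bullet> x)" if "x \<in> S" for x
    proof (cases "x = 0")
      case False
      then have "f (x /\<^sub>R norm x) \<bullet> (x /\<^sub>R norm x) \<le> f e \<bullet> e"
        using that less.prems by (intro e) (auto intro: subspace_scale)
      then show ?thesis
        using False f by (simp add: linear_cmul dot_square_norm field_simps power2_eq_square)
    qed (use f in \<open>simp add: linear_0\<close>)
    from self_adjoint_maximizer_is_eigenvector[OF f sa less.prems eS this]
    have fe: "f e = (f e \<bullet> e) *\<^sub>R e" .
    define S' where "S' = {x \<in> S. e \<bullet> x = 0}"
    have "subspace S'"
      using less.prems unfolding S'_def
      by (auto simp: subspace_def inner_add_right)
    have "e \<notin> S'" using eS by (auto simp: S'_def dot_square_norm)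
    moreover have "S' \<subseteq> S" by (auto simp: S'_def)
    ultimately have "S' \<subset> S" using eS by blast
    then have "dim S' < dim S"
      using \<open>subspace S'\<close> less.prems by (intro dim_psubset) (simp add: span_eq_iff[THEN iffD2])
    moreover have "f ` S' \<subseteq> S'"
    proof
      fix z assume "z \<in> f ` S'"
      then obtain x where x: "x \<in> S'" "z = f x" by blast
      have "e \<bullet> f x = (f e \<bullet> e) * (e \<bullet> x)" by (metis fe inner_scaleR_left sa)
      with x less.prems show "z \<in> S'" by (auto simp: S'_def)
    qed
    ultimately obtain B where B: "B \<subseteq> S'" "span B = S'" "pairwise orthogonal B"
      "\<forall>b\<in>B. norm b = 1 \<and> (\<exists>c. f b = c *\<^sub>R b)"
      using less.hyps[OF _ \<open>subspace S'\<close>] by blast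
    have "span (insert e B) = S"
    proof
      show "span (insert e B) \<subseteq> S"
        using B eS less.prems by (intro span_minimal) (auto simp: S'_def)
      show "S \<subseteq> span (insert e B)"
      proof
        fix x assume "x \<in> S"
        then have "x - (e \<bullet> x) *\<^sub>R e \<in> S'"
          using eS less.prems
          by (auto simp: S'_def inner_diff_right dot_square_norm intro: subspace_diff subspace_scale)
        then have "x - (e \<bullet> x) *\<^sub>R e \<in> span B" using B by simp
        then show "x \<in> span (insert e B)" by (auto simp: span_breakdown_eq)
      qed
    qed
    moreover have "pairwise orthogonal (insert e B)"
      using B by (auto simp: pairwise_insert orthogonal_def S'_def inner_commute)
    moreover have "\<exists>c. f e = c *\<^sub>R e" using fe by blast
    ultimately show ?thesis
      using B eS by (intro exI[of _ "insert e B"]) (auto simp: S'_def)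
  qed
qed

lemma symmetric_matrix_diagonalizable:
  fixes A :: "real^'n^'n"
  assumes sym: "transpose A = A"
  obtains U where "orthogonal_matrix U" "\<And>i j. i \<noteq> j \<Longrightarrow> (transpose U ** A ** U) $ i $ j = 0"
proof -
  have "(A *v x) \<bullet> y = x \<bullet> (A *v y)" for x y :: "real^'n"
    using dot_lmul_matrix[of x A y] sym transpose_matrix_vector[of A x] by simp
  then obtain B where B: "span B = (UNIV :: (real^'n) set)" "pairwise orthogonal B"
    "\<And>b. b \<in> B \<Longrightarrow> norm b = 1" "\<And>b. b \<in> B \<Longrightarrow> \<exists>c. A *v b = c *\<^sub>R b"
    using orthonormal_eigenbasis_subspace[of "(*v) A" UNIV] by auto
  have "0 \<notin> B" using B(3) by force
  then have ind: "independent B" using B(2) by (rule pairwise_orthogonal_independent[rotated])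
  have "finite B" using ind by (rule independent_imp_finite)
  have "card B = CARD('n)"
    using dim_span_eq_card_independent[OF ind] B(1) by simp
  then obtain e where e: "bij_betw e (UNIV :: 'n set) B"
    using \<open>finite B\<close> finite_same_card_bij[of "UNIV :: 'n set" B] by auto
  then have eB: "e j \<in> B" for j by (auto dest: bij_betwE)
  have orth: "e i \<bullet> e j = 0" if "i \<noteq> j" for i j
  proof -
    have "e i \<noteq> e j" using e that by (auto simp: bij_betw_def dest: injD)
    then show ?thesis using pairwiseD[OF B(2) eB eB] by (simp add: orthogonal_def)
  qed
  define U :: "real^'n^'n" where "U = (\<chi> i j. e j $ i)"
  have col: "column j U = e j" for j by (simp add: U_def column_def vec_eq_iff)
  have "orthogonal_matrix U"
    unfolding orthogonal_matrix_orthonormal_columns using orth B(3) eB by (auto simp: col orthogonal_def)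
  moreover have "(transpose U ** A ** U) $ i $ j = 0" if "i \<noteq> j" for i j
  proof -
    obtain c where c: "A *v e j = c *\<^sub>R e j" using B(4) eB by blast
    have "(transpose U ** (A ** U)) $ i $ j = e i \<bullet> column j (A ** U)"
      by (simp add: matrix_matrix_mult_def transpose_def U_def column_def inner_vec_def)
    also have "column j (A ** U) = A *v e j"
      by (simp add: vec_eq_iff column_def matrix_vector_mult_def matrix_matrix_mult_def U_def)
    finally show ?thesis using orth[OF that] by (simp add: c matrix_mul_assoc)
  qed
  ultimately show thesis by (rule that)
qed

section \<open>Algebraic inequalities behind the bound 4\<close>

lemma one_plus_sum_le_prod:
  fixes a :: "'i \<Rightarrow> real"
  assumes "finite I" "\<And>i. i \<in> I \<Longrightarrow> a i \<ge> 0"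
  shows "1 + (\<Sum>i\<in>I. a i) \<le> (\<Prod>i\<in>I. 1 + a i)"
  using assms
proof (induction I)
  case (insert i I)
  have "1 + (\<Sum>j\<in>insert i I. a j) \<le> (1 + a i) * (1 + (\<Sum>j\<in>I. a j))"
    using insert by (simp add: algebra_simps sum_nonneg)
  also have "\<dots> \<le> (1 + a i) * (\<Prod>j\<in>I. 1 + a j)"
    using insert by (intro mult_left_mono) auto
  finally show ?case using insert by simp
qed simp

text \<open>The arithmetic-geometric mean inequality gives (1 + sqrt(p b))^2 <= (1 + p)(1 + b) <=
  4.\<close>

lemma product_le_1_if_product_one_plus_le_4:
  fixes p b :: real
  assumes "p \<ge> 0" "b \<ge> 0" "(1 + p) * (1 + b) \<le> 4"
  shows "p * b \<le> 1"
proof -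
  have "(1 + sqrt (p * b))\<^sup>2 \<le> (1 + p) * (1 + b)"
  proof -
    have "0 \<le> (sqrt p - sqrt b)\<^sup>2" by simp
    then have "2 * sqrt (p * b) \<le> p + b"
      using assms by (simp add: power2_diff real_sqrt_mult)
    then show ?thesis using assms by (simp add: power2_sum algebra_simps)
  qed
  also have "\<dots> \<le> 2\<^sup>2" using assms by simp
  finally have "1 + sqrt (p * b) \<le> 2" by (rule power2_le_imp_le) simp
  then show ?thesis by simp
qed

text \<open>If some \<open>l i\<close> exceeds 1, minimize over the corresponding \<open>x i\<close>; the rest is Cauchy--Schwarz
  and the constraint, which gives \<open>(l i)\<^sup>2 * (\<Sum>j\<noteq>i. (l j)\<^sup>2) \<le> 1\<close>.\<close>

lemma diagonal_form_nonneg: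
  fixes l x :: "'i::finite \<Rightarrow> real"
  assumes prod: "(\<Prod>i\<in>UNIV. 1 + (l i)\<^sup>2) \<le> 4"
  shows "0 \<le> (\<Sum>i\<in>UNIV. (1 - (l i)\<^sup>2) * (x i)\<^sup>2) + (\<Sum>i\<in>UNIV. l i * x i)\<^sup>2"
proof (cases "\<forall>i. (l i)\<^sup>2 \<le> 1")
  case True
  then show ?thesis by (intro add_nonneg_nonneg sum_nonneg mult_nonneg_nonneg) auto
next
  case False
  then obtain i where i: "(l i)\<^sup>2 > 1" using not_le by blast
  let ?I = "UNIV - {i}"
  define p where "p = (l i)\<^sup>2"
  define b where "b = (\<Sum>j\<in>?I. (l j)\<^sup>2)"
  define y where "y = (\<Sum>j\<in>?I. l j * x j)"
  define z where "z = (\<Sum>j\<in>?I. (x j)\<^sup>2)"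
  have nn: "b \<ge> 0" "z \<ge> 0" by (auto simp: b_def z_def intro: sum_nonneg)
  have "(1 + p) * (1 + b) \<le> (1 + p) * (\<Prod>j\<in>?I. 1 + (l j)\<^sup>2)"
    unfolding b_def p_def by (intro mult_left_mono one_plus_sum_le_prod) auto
  also have "\<dots> = (\<Prod>j\<in>UNIV. 1 + (l j)\<^sup>2)"
    by (simp add: p_def prod.remove[of UNIV i])
  finally have "p * b \<le> 1"
    using prod nn by (intro product_le_1_if_product_one_plus_le_4) (auto simp: p_def)
  have "y\<^sup>2 \<le> b * z"
    unfolding y_def b_def z_def by (rule Cauchy_Schwarz_ineq_sum)
  \<comment> \<open>Each single \<open>(l j)^2\<close> with \<open>j \<noteq> i\<close> is at most
    their sum \<open>b\<close>.\<close>
  have "(1 - b) * z \<le> (\<Sum>j\<in>?I. (1 - (l j)\<^sup>2) * (x j)\<^sup>2)"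
    unfolding z_def sum_distrib_left b_def
    by (intro sum_mono mult_right_mono diff_left_mono member_le_sum) auto
  moreover have "(p - 1) * y\<^sup>2 \<le> (1 - b) * z"
  proof -
    have "(p - 1) * y\<^sup>2 \<le> (p - 1) * (b * z)"
      using \<open>y\<^sup>2 \<le> b * z\<close> i by (intro mult_left_mono) (auto simp: p_def)
    also have "\<dots> = (p * b - b) * z" by (simp add: algebra_simps)
    also have "\<dots> \<le> (1 - b) * z" using \<open>p * b \<le> 1\<close> nn by (intro mult_right_mono) auto
    finally show ?thesis .
  qed
  \<comment> \<open>The minimum over \<open>x i\<close> of the first two terms is
    \<open>- (p - 1) * y^2\<close>; adding its negative completes the square.\<close>
  moreover have "0 \<le> (1 - p) * (x i)\<^sup>2 + (l i * x i + y)\<^sup>2 + (p - 1) * y\<^sup>2"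
  proof -
    have "(1 - p) * (x i)\<^sup>2 + (l i * x i + y)\<^sup>2 + (p - 1) * y\<^sup>2 = (x i + l i * y)\<^sup>2"
      by (simp add: p_def power2_eq_square algebra_simps)
    then show ?thesis by simp
  qed
  ultimately show ?thesis
    by (simp add: sum.remove[of UNIV i] p_def y_def)
qed

text \<open>Stated for norms at most 1 rather than equal to 1, so that it applies to
  \<open>sgn (P b)\<close> also where \<open>P b = 0\<close>.\<close>

lemma bessel_inequality:
  fixes f :: "'i \<Rightarrow> 'b::real_inner"
  assumes "finite I" and orth: "\<And>i j. i \<in> I \<Longrightarrow> j \<in> I \<Longrightarrow> i \<noteq> j \<Longrightarrow> f i \<bullet> f j = 0"
    and norm: "\<And>i. i \<in> I \<Longrightarrow> norm (f i) \<le> 1"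
  shows "(\<Sum>i\<in>I. (q \<bullet> f i)\<^sup>2) \<le> q \<bullet> q"
proof -
  let ?s = "\<Sum>i\<in>I. (q \<bullet> f i) *\<^sub>R f i"
  have "?s \<bullet> ?s = (\<Sum>i\<in>I. \<Sum>j\<in>I. (q \<bullet> f i) * (q \<bullet> f j) * (f j \<bullet> f i))"
    by (simp only: inner_sum_left inner_scaleR_left inner_sum_right inner_scaleR_right sum_distrib_left mult.assoc)
  also have "\<dots> = (\<Sum>i\<in>I. \<Sum>j\<in>I. if j = i then (q \<bullet> f i)\<^sup>2 * (f i \<bullet> f i) else 0)"
    using orth by (intro sum.cong) (auto simp: power2_eq_square)
  also have "\<dots> \<le> (\<Sum>i\<in>I. (q \<bullet> f i)\<^sup>2)"
    using \<open>finite I\<close> norm by (auto intro!: sum_mono mult_left_le simp: dot_square_norm power_le_one)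
  finally have "?s \<bullet> ?s \<le> (\<Sum>i\<in>I. (q \<bullet> f i)\<^sup>2)" .
  moreover have "q \<bullet> ?s = (\<Sum>i\<in>I. (q \<bullet> f i)\<^sup>2)" by (simp add: inner_sum_right power2_eq_square)
  moreover have "0 \<le> (q - ?s) \<bullet> (q - ?s)" by simp
  ultimately show ?thesis by (simp add: inner_diff_left inner_diff_right inner_commute)
qed

text \<open>Only the components \<open>w a b\<close> of \<open>q a\<close> along the directions of
  the \<open>P b\<close> enter \<open>S\<close>; Bessel's inequality discards the rest. The form
  then splits: an off-diagonal pair is nonnegative because \<open>l a * l b \<le> 1\<close>, and the
  diagonal entries together with the squared trace form the quadratic form of
  \<open>diagonal_form_nonneg\<close> in \<open>\<kappa> a * w a a\<close>.\<close>

lemma area_hessian_nonneg_diagonal: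
  fixes P q :: "'i::finite \<Rightarrow> 'b::real_inner"
  assumes orth: "\<And>a b. a \<noteq> b \<Longrightarrow> P a \<bullet> P b = 0"
    and prod: "(\<Prod>a\<in>UNIV. 1 + P a \<bullet> P a) \<le> 4"
  defines "\<kappa> \<equiv> \<lambda>a. 1 / (1 + P a \<bullet> P a)" and "S \<equiv> \<lambda>a b. P a \<bullet> q b + q a \<bullet> P b"
  shows "0 \<le> (\<Sum>a\<in>UNIV. \<kappa> a * S a a)\<^sup>2 / 4 - (\<Sum>a\<in>UNIV. \<Sum>b\<in>UNIV. \<kappa> a * \<kappa> b * (S a b)\<^sup>2) / 2
    + (\<Sum>a\<in>UNIV. \<kappa> a * (q a \<bullet> q a))"
proof -
  define l where "l a = norm (P a)" for a
  define w where "w a b = q a \<bullet> sgn (P b)" for a b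
  have PP: "P a \<bullet> P a = (l a)\<^sup>2" for a by (simp add: l_def dot_square_norm)
  have pos: "1 + (l a)\<^sup>2 > 0" for a by (simp add: add_pos_nonneg)
  then have \<kappa>: "\<kappa> a > 0" "\<kappa> a * (1 + (l a)\<^sup>2) = 1" for a
    by (auto simp: \<kappa>_def PP less_imp_neq[symmetric])
  have "P b = l b *\<^sub>R sgn (P b)" for b
    by (cases "P b = 0") (auto simp: l_def sgn_div_norm)
  then have S: "S a b = l a * w b a + l b * w a b" for a b
    unfolding S_def w_def by (metis inner_commute inner_scaleR_right)
  have bessel: "(\<Sum>b\<in>UNIV. (w a b)\<^sup>2) \<le> q a \<bullet> q a" for a
  proof -
    have "sgn (P b) \<bullet> sgn (P c) = 0" if "b \<noteq> c" for b c
      using orth[OF that] by (simp add: sgn_div_norm)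
    then show ?thesis
      unfolding w_def by (intro bessel_inequality) (auto simp: norm_sgn)
  qed
  have ll: "l a * l b \<le> 1" if "a \<noteq> b" for a b
  proof -
    have "(1 + (l a)\<^sup>2) * (1 + (l b)\<^sup>2) = (\<Prod>c\<in>{a, b}. 1 + (l c)\<^sup>2)" using that by simp
    also have "\<dots> \<le> (\<Prod>c\<in>UNIV. 1 + (l c)\<^sup>2)"
      by (intro prod_mono2) auto
    finally have "(l a)\<^sup>2 * (l b)\<^sup>2 \<le> 1"
      using prod by (intro product_le_1_if_product_one_plus_le_4) (auto simp: PP)
    then have "(l a * l b)\<^sup>2 \<le> 1\<^sup>2" by (simp add: power_mult_distrib)
    then show ?thesis by (rule power2_le_imp_le) simp
  qed
  \<comment> \<open>The contribution of an ordered pair. It has no sign by itself, so it is averaged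
    with that of the reversed pair.\<close>
  define T where "T a b = \<kappa> a * (w a b)\<^sup>2 - \<kappa> a * \<kappa> b * (S a b)\<^sup>2 / 2" for a b
  have T: "(if a = b then (1 - (l a)\<^sup>2) * (\<kappa> a * w a a)\<^sup>2 else 0) \<le> (T a b + T b a) / 2" for a b
  proof -
    have a: "\<kappa> a * (w a b)\<^sup>2 = \<kappa> a * \<kappa> b * ((1 + (l b)\<^sup>2) * (w a b)\<^sup>2)"
    proof -
      have "\<kappa> a * (w a b)\<^sup>2 = \<kappa> a * (w a b)\<^sup>2 * (\<kappa> b * (1 + (l b)\<^sup>2))" by (simp only: \<kappa>(2) mult_1_right)
      then show ?thesis by (simp only: mult_ac)
    qed
    have b: "\<kappa> b * (w b a)\<^sup>2 = \<kappa> a * \<kappa> b * ((1 + (l a)\<^sup>2) * (w b a)\<^sup>2)"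
    proof -
      have "\<kappa> b * (w b a)\<^sup>2 = \<kappa> b * (w b a)\<^sup>2 * (\<kappa> a * (1 + (l a)\<^sup>2))" by (simp only: \<kappa>(2) mult_1_right)
      then show ?thesis by (simp only: mult_ac)
    qed
    have "T a b + T b a = \<kappa> a * (w a b)\<^sup>2 + \<kappa> b * (w b a)\<^sup>2 - \<kappa> a * \<kappa> b * (l a * w b a + l b * w a b)\<^sup>2"
      by (simp add: T_def S algebra_simps)
    also have "\<dots> = \<kappa> a * \<kappa> b * ((w a b)\<^sup>2 + (w b a)\<^sup>2 - 2 * (l a * l b) * (w a b * w b a))"
      unfolding a b by (simp add: power2_eq_square algebra_simps)
    finally have eq: "T a b + T b a = \<kappa> a * \<kappa> b * ((w a b)\<^sup>2 + (w b a)\<^sup>2 - 2 * (l a * l b) * (w a b * w b a))" .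
    show ?thesis
    proof (cases "a = b")
      case True
      then show ?thesis using eq by (simp add: power2_eq_square algebra_simps)
    next
      case False
      have "2 * (l a * l b) * (w a b * w b a) \<le> 2 * \<bar>w a b * w b a\<bar>"
      proof -
        have "(l a * l b) * (w a b * w b a) \<le> (l a * l b) * \<bar>w a b * w b a\<bar>"
          by (intro mult_left_mono) (auto simp: l_def)
        also have "\<dots> \<le> 1 * \<bar>w a b * w b a\<bar>"
          using ll[OF False] by (intro mult_right_mono) auto
        finally show ?thesis by simp
      qed
      also have "\<dots> \<le> (w a b)\<^sup>2 + (w b a)\<^sup>2"
        using sum_squares_bound[of "\<bar>w a b\<bar>" "\<bar>w b a\<bar>"] by (simp add: abs_mult mult.assoc)
      finally show ?thesis using False eq \<kappa>(1)[of a] \<kappa>(1)[of b] by simp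
    qed
  qed
  have "(\<Sum>a\<in>UNIV. (1 - (l a)\<^sup>2) * (\<kappa> a * w a a)\<^sup>2)
      = (\<Sum>a\<in>UNIV. \<Sum>b\<in>UNIV. if a = b then (1 - (l a)\<^sup>2) * (\<kappa> a * w a a)\<^sup>2 else 0)"
    by simp
  also have "\<dots> \<le> (\<Sum>a\<in>UNIV. \<Sum>b\<in>UNIV. (T a b + T b a) / 2)"
    by (intro sum_mono T)
  also have "\<dots> = (\<Sum>a\<in>UNIV. \<Sum>b\<in>UNIV. T a b)"
    using sum.swap[of T UNIV UNIV] by (simp add: sum.distrib flip: sum_divide_distrib)
  also have "\<dots> = (\<Sum>a\<in>UNIV. \<kappa> a * (\<Sum>b\<in>UNIV. (w a b)\<^sup>2))
      - (\<Sum>a\<in>UNIV. \<Sum>b\<in>UNIV. \<kappa> a * \<kappa> b * (S a b)\<^sup>2) / 2"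
    by (simp add: T_def sum_subtractf sum_distrib_left sum_divide_distrib)
  also have "(\<Sum>a\<in>UNIV. \<kappa> a * (\<Sum>b\<in>UNIV. (w a b)\<^sup>2)) \<le> (\<Sum>a\<in>UNIV. \<kappa> a * (q a \<bullet> q a))"
    using \<kappa>(1) by (intro sum_mono mult_left_mono bessel) (simp add: less_imp_le)
  finally have "(\<Sum>a\<in>UNIV. (1 - (l a)\<^sup>2) * (\<kappa> a * w a a)\<^sup>2)
      \<le> (\<Sum>a\<in>UNIV. \<kappa> a * (q a \<bullet> q a)) - (\<Sum>a\<in>UNIV. \<Sum>b\<in>UNIV. \<kappa> a * \<kappa> b * (S a b)\<^sup>2) / 2"
    by simp
  moreover have "(\<Sum>a\<in>UNIV. \<kappa> a * S a a)\<^sup>2 / 4 = (\<Sum>a\<in>UNIV. l a * (\<kappa> a * w a a))\<^sup>2"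
  proof -
    have "(\<Sum>a\<in>UNIV. \<kappa> a * S a a) = 2 * (\<Sum>a\<in>UNIV. l a * (\<kappa> a * w a a))"
      unfolding sum_distrib_left by (intro sum.cong) (auto simp: S)
    then show ?thesis by (simp add: power_mult_distrib)
  qed
  ultimately show ?thesis
    using diagonal_form_nonneg[of l "\<lambda>a. \<kappa> a * w a a"] prod by (simp add: PP)
qed

section \<open>Rotating a graph frame to diagonal form\<close>

lemma gram_row_comb: "gram (row_comb B X) = B ** gram X ** transpose B"
proof -
  have "(\<Sum>k\<in>UNIV. \<Sum>l\<in>UNIV. B $ i $ k * (B $ j $ l * (X $ k \<bullet> X $ l)))
      = (\<Sum>l\<in>UNIV. \<Sum>k\<in>UNIV. B $ i $ k * (B $ j $ l * (X $ k \<bullet> X $ l)))" for i j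
    by (rule sum.swap)
  then show ?thesis
    by (simp add: gram_def row_comb_def vec_eq_iff matrix_matrix_mult_def transpose_def
        inner_sum_left inner_sum_right sum_distrib_left sum_distrib_right mult_ac)
qed

lemma symgram_eq_gram: "symgram X Y = gram (X + Y) - gram X - gram Y"
  by (simp add: symgram_def gram_def vec_eq_iff inner_add_left inner_add_right)

lemma symgram_row_comb: "symgram (row_comb B X) (row_comb B Y) = B ** symgram X Y ** transpose B"
  by (simp add: symgram_eq_gram gram_row_comb bounded_bilinear.diff_left[OF bounded_bilinear_matrix_mult]
      bounded_bilinear.diff_right[OF bounded_bilinear_matrix_mult]
      flip: bounded_bilinear.add_right[OF bounded_bilinear_row_comb])

lemma trace_row_comb_gram: "row_comb A Y \<bullet> Y = trace (A ** gram Y)"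
  by (simp add: trace_def matrix_matrix_mult_def gram_def inner_vec_def row_comb_def inner_sum_left)

lemma matrix_inv_unique:
  fixes A B :: "real^'n^'n"
  assumes "A ** B = mat 1"
  shows "matrix_inv A = B"
proof -
  have "det A \<noteq> 0" using assms by (metis det_I det_mul mult_zero_left zero_neq_one)
  then have "matrix_inv A = matrix_inv A ** (A ** B)" by (simp add: assms)
  also have "\<dots> = B" using \<open>det A \<noteq> 0\<close> by (simp add: matrix_mul_assoc matrix_inv_left_det)
  finally show ?thesis .
qed

text \<open>A rotation of the frame conjugates the inverse Gram matrix and the polarized Gram
  matrices by \<open>B\<close>, and the Hessian depends on them only through traces of products and
  the determinant.\<close>

lemma flux_deriv_orthogonal_invariant:
  fixes X Y :: "'a::euclidean_space^'n"
  assumes B: "orthogonal_matrix B" and det: "det (gram X) \<noteq> 0"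
  shows "flux_deriv (row_comb B X) (row_comb B Y) \<bullet> row_comb B Y = flux_deriv X Y \<bullet> Y"
proof -
  let ?H = "matrix_inv (gram X)" and ?S = "symgram X Y"
  have BB: "transpose B ** B = mat 1" "B ** transpose B = mat 1"
    using B by (auto simp: orthogonal_matrix_def)
  have BB': "transpose B ** (B ** A) = A" "B ** (transpose B ** A) = A" for A :: "real^'n^'n"
    by (simp_all add: matrix_mul_assoc BB)
  have inv: "matrix_inv (gram (row_comb B X)) = B ** ?H ** transpose B"
    by (rule matrix_inv_unique)
      (simp add: gram_row_comb BB BB' matrix_inv_right_det[OF det, THEN arg_cong[of _ _ "\<lambda>A. A ** _"]]
        flip: matrix_mul_assoc, metis matrix_inv_right_det[OF det] BB(2) matrix_mul_assoc matrix_mul_lid)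
  have tr: "trace (B ** A ** transpose B) = trace A" for A :: "real^'n^'n"
    using trace_mul_sym[of B "A ** transpose B"] BB by (simp flip: matrix_mul_assoc)
  have "det (B ** transpose B) = 1" by (simp only: BB det_I)
  then have det_eq: "det (gram (row_comb B X)) = det (gram X)"
    by (simp add: gram_row_comb det_mul)
  have eq: "(B ** ?H ** transpose B) ** (B ** M ** transpose B) = B ** (?H ** M) ** transpose B" for M
    by (simp add: BB' flip: matrix_mul_assoc)
  have eq2: "(B ** M ** transpose B) ** (B ** N ** transpose B) = B ** (M ** N) ** transpose B" for M N :: "real^'n^'n"
    by (simp add: BB' flip: matrix_mul_assoc)
  show ?thesis
    by (subst (1 2) flux_deriv_inner)
      (simp_all only: det det_eq not_False_eq_True inv symgram_row_comb trace_row_comb_gram gram_row_comb[of B Y]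
        eq eq2 tr vol_def simp_thms)
qed

lemma diagonal_matrix_mult:
  "(\<chi> i j. if i = j then a i else 0) ** (M :: real^'k^'n) = (\<chi> i j. a i * M $ i $ j)"
  by (simp add: vec_eq_iff matrix_matrix_mult_def mult_delta_left)

lemma row_comb_diagonal:
  "row_comb (\<chi> i j. if i = j then a i else 0) X = (\<chi> i. a i *\<^sub>R X $ i)"
  by (simp add: vec_eq_iff row_comb_def if_distrib[of "\<lambda>x. x *\<^sub>R _"] cong: if_cong)

text \<open>Pairs \<open>(u, p)\<close> are split into the horizontal part \<open>u\<close> and the vertical part \<open>p\<close>.
  The gram matrix of \<open>X\<close> is \<open>I\<close> plus that of the vertical parts; rotating the horizontal frame
  makes the vertical parts orthogonal.\<close>

lemma graph_frame_diagonalizable: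
  fixes X :: "('a::euclidean_space \<times> 'b::euclidean_space)^'n"
  assumes hor: "\<And>i j. fst (X $ i) \<bullet> fst (X $ j) = (if i = j then 1 else 0)"
  obtains B where "orthogonal_matrix B"
    "\<And>i j. i \<noteq> j \<Longrightarrow> snd (row_comb B X $ i) \<bullet> snd (row_comb B X $ j) = 0"
    "gram (row_comb B X) = (\<chi> i j. if i = j then 1 + snd (row_comb B X $ i) \<bullet> snd (row_comb B X $ i) else 0)"
    "det (gram X) = (\<Prod>i\<in>UNIV. 1 + snd (row_comb B X $ i) \<bullet> snd (row_comb B X $ i))"
proof -
  let ?P = "(\<chi> i. snd (X $ i)) :: 'b^'n"
  obtain U where U: "orthogonal_matrix U"
    "\<And>i j. i \<noteq> j \<Longrightarrow> (transpose U ** gram ?P ** U) $ i $ j = 0"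
    using symmetric_matrix_diagonalizable[OF transpose_gram] by blast
  define B where "B = transpose U"
  have B: "orthogonal_matrix B" using U(1) by (simp add: B_def)
  have snd: "snd (row_comb B X $ i) = row_comb B ?P $ i" for i
    by (simp add: row_comb_def snd_sum)
  have gram: "gram X = mat 1 + gram ?P"
    by (simp add: gram_def vec_eq_iff mat_def hor inner_prod_def)
  have "gram (row_comb B X) = mat 1 + gram (row_comb B ?P)"
    using B by (simp add: gram_row_comb gram matrix_add_ldistrib orthogonal_matrix_def
        bounded_bilinear.add_left[OF bounded_bilinear_matrix_mult])
  moreover have orth: "row_comb B ?P $ i \<bullet> row_comb B ?P $ j = 0" if "i \<noteq> j" for i j
  proof -
    have "row_comb B ?P $ i \<bullet> row_comb B ?P $ j = gram (row_comb B ?P) $ i $ j" by (simp add: gram_def)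
    then show ?thesis using U(2)[OF that] by (simp add: gram_row_comb B_def)
  qed
  ultimately have diag: "gram (row_comb B X)
      = (\<chi> i j. if i = j then 1 + snd (row_comb B X $ i) \<bullet> snd (row_comb B X $ i) else 0)"
    by (simp add: vec_eq_iff mat_def gram_def snd)
  have "det (B ** transpose B) = 1" using B by (simp add: orthogonal_matrix_def)
  then have "det (gram X) = det (gram (row_comb B X))"
    by (simp add: gram_row_comb det_mul)
  also have "\<dots> = (\<Prod>i\<in>UNIV. 1 + snd (row_comb B X $ i) \<bullet> snd (row_comb B X $ i))"
    unfolding diag by (subst det_diagonal) auto
  finally show thesis using B orth diag snd by (intro that[of B]) auto
qed

text \<open>Supplies, uniformly over the domain, the positive determinant that the derivative
  formulas for \<open>vol\<close> and \<open>flux\<close> require.\<close>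

lemma det_gram_graph_ge_1:
  fixes X :: "('a::euclidean_space \<times> 'b::euclidean_space)^'n"
  assumes "\<And>i j. fst (X $ i) \<bullet> fst (X $ j) = (if i = j then 1 else 0)"
  shows "det (gram X) \<ge> 1"
proof -
  have ge: "(\<Prod>i\<in>UNIV. 1 + snd (row_comb B X $ i) \<bullet> snd (row_comb B X $ i)) \<ge> 1" for B
    by (rule prod_ge_1) simp
  show ?thesis
    by (rule graph_frame_diagonalizable[where X = X, OF assms]) (simp_all only: ge)
qed

text \<open>Rotating \<open>X\<close> and \<open>Y\<close> by the same matrix keeps \<open>Y\<close>
  vertical, so only the vertical parts of \<open>X\<close> meet \<open>Y\<close> in the polarized
  Gram matrix. In the diagonalizing frame the Hessian is \<open>vol X\<close> times the form of
  \<open>area_hessian_nonneg_diagonal\<close>.\<close>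

lemma flux_deriv_vertical_nonneg:
  fixes X Y :: "('a::euclidean_space \<times> 'b::euclidean_space)^'n"
  assumes hor: "\<And>i j. fst (X $ i) \<bullet> fst (X $ j) = (if i = j then 1 else 0)"
    and vert: "\<And>i. fst (Y $ i) = 0" and det: "det (gram X) \<le> 4"
  shows "0 \<le> flux_deriv X Y \<bullet> Y"
proof -
  obtain B where B: "orthogonal_matrix B"
    "\<And>i j. i \<noteq> j \<Longrightarrow> snd (row_comb B X $ i) \<bullet> snd (row_comb B X $ j) = 0"
    "gram (row_comb B X) = (\<chi> i j. if i = j then 1 + snd (row_comb B X $ i) \<bullet> snd (row_comb B X $ i) else 0)"
    "det (gram X) = (\<Prod>i\<in>UNIV. 1 + snd (row_comb B X $ i) \<bullet> snd (row_comb B X $ i))"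
    by (rule graph_frame_diagonalizable[where X = X, OF hor]) (rule that)
  define P where "P i = snd (row_comb B X $ i)" for i
  define q where "q i = snd (row_comb B Y $ i)" for i
  define \<kappa> where "\<kappa> i = 1 / (1 + P i \<bullet> P i)" for i
  define S where "S i j = P i \<bullet> q j + q i \<bullet> P j" for i j
  have det1: "det (gram X) \<ge> 1" by (rule det_gram_graph_ge_1[OF hor])
  have "det (B ** transpose B) = 1" using B by (simp add: orthogonal_matrix_def)
  then have detB: "det (gram (row_comb B X)) = det (gram X)"
    by (simp add: gram_row_comb det_mul)
  have pos: "1 + P i \<bullet> P i > 0" for i by (simp add: add_pos_nonneg)
  have gramB: "gram (row_comb B X) = (\<chi> i j. if i = j then 1 + P i \<bullet> P i else 0)"
    using B(3) by (simp only: P_def)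
  have "(1 + P i \<bullet> P i) * \<kappa> i = 1" for i using pos[of i] by (simp add: \<kappa>_def)
  then have inv: "matrix_inv (gram (row_comb B X)) = (\<chi> i j. if i = j then \<kappa> i else 0)"
    unfolding gramB
    by (intro matrix_inv_unique) (simp add: diagonal_matrix_mult vec_eq_iff mat_def)
  have Y0: "fst (row_comb B Y $ i) = 0" for i
    by (simp add: row_comb_def fst_sum vert)
  have sym: "symgram (row_comb B X) (row_comb B Y) = (\<chi> i j. S i j)"
    by (simp add: symgram_def vec_eq_iff inner_prod_def Y0 S_def P_def q_def)
  have Sc: "S i j = S j i" for i j by (simp add: S_def inner_commute)
  have "0 \<le> (\<Sum>a\<in>UNIV. \<kappa> a * S a a)\<^sup>2 / 4 - (\<Sum>a\<in>UNIV. \<Sum>b\<in>UNIV. \<kappa> a * \<kappa> b * (S a b)\<^sup>2) / 2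
    + (\<Sum>a\<in>UNIV. \<kappa> a * (q a \<bullet> q a))"
    unfolding \<kappa>_def S_def using B(2,4) det by (intro area_hessian_nonneg_diagonal) (auto simp: P_def)
  moreover have "flux_deriv (row_comb B X) (row_comb B Y) \<bullet> row_comb B Y = vol X *
    ((\<Sum>a\<in>UNIV. \<kappa> a * S a a)\<^sup>2 / 4 - (\<Sum>a\<in>UNIV. \<Sum>b\<in>UNIV. \<kappa> a * \<kappa> b * (S a b)\<^sup>2) / 2
    + (\<Sum>a\<in>UNIV. \<kappa> a * (q a \<bullet> q a)))"
  proof -
    have 1: "trace (\<chi> i j. \<kappa> i * S i j) = (\<Sum>a\<in>UNIV. \<kappa> a * S a a)"
      by (simp add: trace_def)
    have 3: "trace ((\<chi> i j. \<kappa> i * S i j) ** (\<chi> i j. \<kappa> i * S i j))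
        = (\<Sum>a\<in>UNIV. \<Sum>b\<in>UNIV. \<kappa> a * \<kappa> b * (S a b)\<^sup>2)"
      using Sc by (simp add: trace_def matrix_matrix_mult_def power2_eq_square mult_ac)
    have 4: "(\<chi> i. \<kappa> i *\<^sub>R row_comb B Y $ i) \<bullet> row_comb B Y = (\<Sum>a\<in>UNIV. \<kappa> a * (q a \<bullet> q a))"
      by (simp add: inner_vec_def inner_prod_def Y0 q_def)
    have "det (gram (row_comb B X)) \<noteq> 0" using detB det1 by simp
    then show ?thesis
      by (simp add: flux_deriv_inner inv sym diagonal_matrix_mult row_comb_diagonal 1 3 4 detB vol_def
          power2_eq_square)
  qed
  moreover have "vol X \<ge> 0" using det1 by (simp add: vol_def)
  ultimately have "0 \<le> flux_deriv (row_comb B X) (row_comb B Y) \<bullet> row_comb B Y" by simp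
  then show ?thesis using flux_deriv_orthogonal_invariant[OF B(1), of X Y] det1 by simp
qed

section \<open>The minimal surface system in divergence form\<close>

text \<open>The coordinate tangent frame of a parametrization, through which the calculus on frames
  is applied to maps.\<close>

definition jac :: "(real ^ 'n \<Rightarrow> 'a::euclidean_space) \<Rightarrow> real ^ 'n \<Rightarrow> 'a ^ 'n" where
  "jac F x = (\<chi> i. partial_deriv F i x)"

lemma jac_nth [simp]: "jac F x $ i = partial_deriv F i x"
  by (simp add: jac_def)

lemma partial_deriv_eqI:
  "(F has_derivative F') (at x) \<Longrightarrow> partial_deriv F i x = F' (axis i 1)"
  unfolding partial_deriv_def by (metis frechet_derivative_at)

lemma differentiable_imp_has_derivative_frechet:
  "F differentiable at x \<Longrightarrow> (F has_derivative frechet_derivative F (at x)) (at x)"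
  by (simp add: frechet_derivative_works)

lemma partial_deriv_bilinear:
  assumes "bounded_bilinear b" "F differentiable at x" "G differentiable at x"
  shows "partial_deriv (\<lambda>x. b (F x) (G x)) i x = b (F x) (partial_deriv G i x) + b (partial_deriv F i x) (G x)"
  unfolding partial_deriv_def[of F] partial_deriv_def[of G]
  by (rule partial_deriv_eqI[OF bounded_bilinear.FDERIV[OF assms(1) assms(2,3)[THEN differentiable_imp_has_derivative_frechet]]])

lemma partial_deriv_bounded_linear:
  assumes "bounded_linear L" "F differentiable at x"
  shows "partial_deriv (\<lambda>x. L (F x)) i x = L (partial_deriv F i x)"
  unfolding partial_deriv_def[of F]
  by (rule partial_deriv_eqI[OF bounded_linear.has_derivative[OF assms(1) assms(2)[THEN differentiable_imp_has_derivative_frechet]]])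

lemma partial_deriv_sum:
  assumes "\<And>j. j \<in> I \<Longrightarrow> F j differentiable at x"
  shows "partial_deriv (\<lambda>x. \<Sum>j\<in>I. F j x) i x = (\<Sum>j\<in>I. partial_deriv (F j) i x)"
  unfolding partial_deriv_def[of "F _"]
  by (rule partial_deriv_eqI[OF has_derivative_sum]) (rule assms[THEN differentiable_imp_has_derivative_frechet])

lemma partial_deriv_add:
  assumes "F differentiable at x" "G differentiable at x"
  shows "partial_deriv (\<lambda>x. F x + G x) i x = partial_deriv F i x + partial_deriv G i x"
  unfolding partial_deriv_def[of F] partial_deriv_def[of G]
  by (rule partial_deriv_eqI[OF has_derivative_add[OF assms[THEN differentiable_imp_has_derivative_frechet]]])

lemma partial_deriv_diff:
  assumes "F differentiable at x" "G differentiable at x"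
  shows "partial_deriv (\<lambda>x. F x - G x) i x = partial_deriv F i x - partial_deriv G i x"
  unfolding partial_deriv_def[of F] partial_deriv_def[of G]
  by (rule partial_deriv_eqI[OF has_derivative_diff[OF assms[THEN differentiable_imp_has_derivative_frechet]]])

lemma partial_deriv_cong:
  assumes "open D" "x \<in> D" "F differentiable at x" "\<And>y. y \<in> D \<Longrightarrow> F y = G y"
  shows "partial_deriv F i x = partial_deriv G i x"
  unfolding partial_deriv_def
  by (simp add: frechet_derivative_transform_within_open[OF assms(3,1,2,4)])

lemma diff_times_on_imp_differentiable:
  "diff_times_on (Suc k) D F \<Longrightarrow> x \<in> D \<Longrightarrow> F differentiable at x"
  by simp

lemma diff_times_on_partial_deriv:
  "diff_times_on (Suc k) D F \<Longrightarrow> diff_times_on k D (partial_deriv F i)"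
  unfolding partial_deriv_def[abs_def] by simp

lemma diff_times_on_jac:
  "open D \<Longrightarrow> diff_times_on (Suc k) D F \<Longrightarrow> diff_times_on k D (jac F)"
  unfolding jac_def[abs_def] by (intro diff_times_on_vec_lambda diff_times_on_partial_deriv)

lemma partial_deriv_symmetric:
  assumes "open D" "diff_times_on 2 D F" "x \<in> D"
  shows "partial_deriv (partial_deriv F i) j x = partial_deriv (partial_deriv F j) i x"
  using second_derivative_symmetric[OF assms] by (simp add: partial_deriv_def[abs_def])

lemma partial_deriv_jac:
  assumes "open D" "diff_times_on 2 D F" "x \<in> D"
  shows "partial_deriv (jac F) k x $ i = partial_deriv (partial_deriv F i) k x"
proof -
  have "jac F differentiable at x"
    using diff_times_on_jac[of D 1 F] assms diff_times_on_imp_differentiable[of 0 D "jac F" x]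
    by (simp add: numeral_2_eq_2)
  from partial_deriv_bounded_linear[OF bounded_linear_vec_nth this, of i k] show ?thesis by simp
qed

lemma partial_deriv_flux_jac:
  assumes "jac F differentiable at x" "det (gram (jac F x)) > 0"
  shows "partial_deriv (\<lambda>x. flux (jac F x)) k x = flux_deriv (jac F x) (partial_deriv (jac F) k x)"
  unfolding partial_deriv_def[of "jac F"]
  by (rule partial_deriv_eqI[OF has_derivative_compose[OF assms(1)[THEN differentiable_imp_has_derivative_frechet]
        flux_has_derivative[OF assms(2)]]])

lemma induced_metric_eq_gram: "induced_metric F x = gram (jac F x)"
  by (simp add: induced_metric_def gram_def vec_eq_iff)

lemma volume_over_eq: "volume_over K F = (LINT x:K|lborel. vol (jac F x))"
  by (simp add: volume_over_def vol_def induced_metric_eq_gram)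

text \<open>\<open>A k $ i\<close> stands for the second derivative of \<open>F\<close> in
  directions \<open>k\<close> and \<open>i\<close>, and the conclusion for the divergence of
  \<open>flux (jac F)\<close>. In terms of the dual frame \<open>Z\<close>, the contribution of the
  density cancels one half of that of the inverse metric by symmetry of \<open>A\<close>; everything
  left contains the contraction of \<open>A\<close> with the inverse metric, which is zero.\<close>

lemma flux_divergence_eq_0:
  fixes X :: "'a::euclidean_space^'n" and A :: "'n \<Rightarrow> 'a^'n"
  assumes det: "det (gram X) \<noteq> 0" and sym: "\<And>i k. A k $ i = A i $ k"
    and L: "(\<Sum>i\<in>UNIV. \<Sum>j\<in>UNIV. matrix_inv (gram X) $ i $ j *\<^sub>R A i $ j) = 0"
  shows "(\<Sum>k\<in>UNIV. flux_deriv X (A k) $ k) = 0"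
proof -
  define H where "H = matrix_inv (gram X)"
  define Z where "Z = row_comb H X"
  have H: "transpose H = H" unfolding H_def by (rule transpose_matrix_inv_gram[OF det])
  have 1: "trace (H ** symgram X (A k)) = 2 * (\<Sum>i\<in>UNIV. Z $ i \<bullet> A k $ i)" for k
    by (simp add: trace_mult_symgram[OF H] Z_def inner_vec_def)
  have "(\<Sum>k\<in>UNIV. row_comb (H ** symgram X (A k) ** H) X $ k)
      = (\<Sum>k\<in>UNIV. row_comb H (row_comb (symgram X (A k)) Z) $ k)"
    by (simp add: row_comb_row_comb Z_def matrix_mul_assoc)
  also have "\<dots> = (\<Sum>k\<in>UNIV. \<Sum>a\<in>UNIV. \<Sum>b\<in>UNIV. (H $ k $ a * (X $ a \<bullet> A k $ b)) *\<^sub>R Z $ b)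
      + (\<Sum>k\<in>UNIV. \<Sum>a\<in>UNIV. \<Sum>b\<in>UNIV. (H $ k $ a * (A k $ a \<bullet> X $ b)) *\<^sub>R Z $ b)"
    by (simp add: row_comb_def symgram_def scaleR_sum_right sum.distrib scaleR_add_left scaleR_add_right distrib_left)
  also have "(\<Sum>k\<in>UNIV. \<Sum>a\<in>UNIV. \<Sum>b\<in>UNIV. (H $ k $ a * (A k $ a \<bullet> X $ b)) *\<^sub>R Z $ b) = 0"
  proof -
    have "(\<Sum>k\<in>UNIV. \<Sum>a\<in>UNIV. \<Sum>b\<in>UNIV. (H $ k $ a * (A k $ a \<bullet> X $ b)) *\<^sub>R Z $ b)
        = (\<Sum>k\<in>UNIV. \<Sum>b\<in>UNIV. \<Sum>a\<in>UNIV. (H $ k $ a * (A k $ a \<bullet> X $ b)) *\<^sub>R Z $ b)"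
      by (rule sum.cong[OF refl], rule sum.swap)
    also have "\<dots> = (\<Sum>b\<in>UNIV. \<Sum>k\<in>UNIV. \<Sum>a\<in>UNIV. (H $ k $ a * (A k $ a \<bullet> X $ b)) *\<^sub>R Z $ b)"
      by (rule sum.swap)
    also have "\<dots> = (\<Sum>b\<in>UNIV. ((\<Sum>k\<in>UNIV. \<Sum>a\<in>UNIV. H $ k $ a *\<^sub>R A k $ a) \<bullet> X $ b) *\<^sub>R Z $ b)"
      by (simp add: inner_sum_left scaleR_sum_left)
    finally show ?thesis using L by (simp add: H_def)
  qed
  also have "(\<Sum>k\<in>UNIV. \<Sum>a\<in>UNIV. \<Sum>b\<in>UNIV. (H $ k $ a * (X $ a \<bullet> A k $ b)) *\<^sub>R Z $ b)
      = (\<Sum>b\<in>UNIV. (\<Sum>k\<in>UNIV. Z $ k \<bullet> A k $ b) *\<^sub>R Z $ b)"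
  proof -
    have "(\<Sum>k\<in>UNIV. \<Sum>a\<in>UNIV. \<Sum>b\<in>UNIV. (H $ k $ a * (X $ a \<bullet> A k $ b)) *\<^sub>R Z $ b)
        = (\<Sum>k\<in>UNIV. \<Sum>b\<in>UNIV. \<Sum>a\<in>UNIV. (H $ k $ a * (X $ a \<bullet> A k $ b)) *\<^sub>R Z $ b)"
      by (rule sum.cong[OF refl], rule sum.swap)
    also have "\<dots> = (\<Sum>b\<in>UNIV. \<Sum>k\<in>UNIV. \<Sum>a\<in>UNIV. (H $ k $ a * (X $ a \<bullet> A k $ b)) *\<^sub>R Z $ b)"
      by (rule sum.swap)
    finally show ?thesis
      by (simp add: Z_def row_comb_def inner_sum_left scaleR_sum_left)
  qed
  also have "\<dots> = (\<Sum>k\<in>UNIV. (\<Sum>i\<in>UNIV. Z $ i \<bullet> A k $ i) *\<^sub>R Z $ k)"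
    by (simp add: sym)
  finally have 2: "(\<Sum>k\<in>UNIV. row_comb (H ** symgram X (A k) ** H) X $ k)
    = (\<Sum>k\<in>UNIV. (\<Sum>i\<in>UNIV. Z $ i \<bullet> A k $ i) *\<^sub>R Z $ k)" by simp
  have 3: "(\<Sum>k\<in>UNIV. row_comb H (A k) $ k) = 0"
    using L by (simp add: H_def row_comb_def)
  have "(\<Sum>k\<in>UNIV. flux_deriv X (A k) $ k) = vol X *\<^sub>R
      ((\<Sum>k\<in>UNIV. (\<Sum>i\<in>UNIV. Z $ i \<bullet> A k $ i) *\<^sub>R Z $ k)
        - (\<Sum>k\<in>UNIV. row_comb (H ** symgram X (A k) ** H) X $ k) + (\<Sum>k\<in>UNIV. row_comb H (A k) $ k))"
    by (simp add: flux_deriv_def Let_def H_def[symmetric] Z_def[symmetric] 1 scaleR_sum_right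
        sum.distrib sum_subtractf scaleR_add_right scaleR_diff_right)
  then show ?thesis by (simp add: 2 3)
qed

lemma partial_deriv_graph_map:
  assumes "f differentiable at x"
  shows "partial_deriv (graph_map f) i x = (axis i 1, partial_deriv f i x)"
  unfolding partial_deriv_def[of f] graph_map_def[abs_def]
  by (rule partial_deriv_eqI[OF has_derivative_Pair[OF has_derivative_ident
        assms[THEN differentiable_imp_has_derivative_frechet]]])

lemma diff_times_on_graph_map:
  fixes f :: "real ^ 'n \<Rightarrow> real ^ 'm"
  assumes "open D" "diff_times_on k D f"
  shows "diff_times_on k D (graph_map f)"
proof -
  have "diff_times_on k D (\<lambda>x. (x, 0 :: real ^ 'm) + (0 :: real ^ 'n, f x))"
    by (intro diff_times_on_add assms diff_times_on_bounded_linear_compose[where L = "\<lambda>y. (0, y)"]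
        diff_times_on_bounded_linear_compose[where L = "\<lambda>x. (x, 0)"] diff_times_on_ident
        bounded_linear_Pair bounded_linear_zero bounded_linear_ident)
  then show ?thesis by (simp add: graph_map_def[abs_def])
qed

lemma gram_jac_graph_map:
  assumes "f differentiable at x"
  shows "fst (jac (graph_map f) x $ i) \<bullet> fst (jac (graph_map f) x $ j) = (if i = j then 1 else 0)"
  by (simp add: partial_deriv_graph_map[OF assms] inner_axis_axis)

text \<open>Minimality only says that the contraction \<open>L\<close> of the second derivatives
  with the inverse metric is tangent. On a graph these second derivatives are vertical, and a
  vertical tangent vector is zero, so \<open>L\<close> itself vanishes.\<close>

lemma minimal_graph_flux_divergence_eq_0:
  fixes f :: "real ^ 'n \<Rightarrow> real ^ 'm"
  assumes "open D" and f: "diff_times_on 2 D f" and min: "minimal_on D (graph_map f)" and x: "x \<in> D"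
  shows "(\<Sum>k\<in>UNIV. flux_deriv (jac (graph_map f) x) (partial_deriv (jac (graph_map f)) k x) $ k) = 0"
proof (rule flux_divergence_eq_0)
  let ?F = "graph_map f"
  let ?X = "jac ?F x" and ?A = "\<lambda>k. partial_deriv (jac ?F) k x"
  let ?H = "matrix_inv (gram ?X)"
  have F: "diff_times_on 2 D ?F" using assms by (intro diff_times_on_graph_map)
  have fx: "f differentiable at x" if "x \<in> D" for x using f that by (simp add: numeral_2_eq_2)
  show "det (gram ?X) \<noteq> 0"
    using det_gram_graph_ge_1[OF gram_jac_graph_map[OF fx[OF x]]] by simp
  show "?A k $ i = ?A i $ k" for i k
    by (simp add: partial_deriv_jac[OF \<open>open D\<close> F x] partial_deriv_symmetric[OF \<open>open D\<close> F x])
  define L where "L = (\<Sum>i\<in>UNIV. \<Sum>j\<in>UNIV. ?H $ i $ j *\<^sub>R ?A i $ j)"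
  have fst_A: "fst (?A i $ j) = 0" for i j
  proof -
    have d: "partial_deriv ?F j differentiable at x"
      using F x by (intro diff_times_on_imp_differentiable[of 0] diff_times_on_partial_deriv) (simp_all add: numeral_2_eq_2)
    have "fst (partial_deriv (partial_deriv ?F j) i x) = partial_deriv (\<lambda>y. fst (partial_deriv ?F j y)) i x"
      by (rule partial_deriv_bounded_linear[OF bounded_linear_fst d, symmetric])
    also have "\<dots> = partial_deriv (\<lambda>y. axis j 1) i x"
      using bounded_linear.has_derivative[OF bounded_linear_fst d[THEN differentiable_imp_has_derivative_frechet]]
      by (intro partial_deriv_cong[OF \<open>open D\<close> x])
        (auto simp: differentiable_def partial_deriv_graph_map[OF fx])
    also have "\<dots> = 0" by (simp add: partial_deriv_def)
    finally show ?thesis by (simp add: partial_deriv_jac[OF \<open>open D\<close> F x])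
  qed
  have fstL: "fst L = 0" by (simp add: L_def fst_sum fst_A)
  \<comment> \<open>Coefficients of the tangential projection of \<open>L\<close>. Since
    \<open>partial_deriv (graph_map f) i\<close> has horizontal part \<open>axis i 1\<close>, they
    are also the horizontal coordinates of that projection.\<close>
  define c where "c i = (\<Sum>j\<in>UNIV. ?H $ i $ j * (L \<bullet> ?X $ j))" for i
  have np: "normal_part ?F x v = v - (\<Sum>i\<in>UNIV. (\<Sum>j\<in>UNIV. ?H $ i $ j * (v \<bullet> ?X $ j)) *\<^sub>R ?X $ i)" for v
    by (simp add: normal_part_def inverse_metric_def induced_metric_eq_gram scaleR_sum_left)
  have lin: "linear (normal_part ?F x)"
    by (rule linearI) (simp_all add: np inner_add_left sum.distrib distrib_left scaleR_add_left
        scaleR_sum_right sum_distrib_left scaleR_diff_right mult.left_commute)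
  have "mean_curvature_vector ?F x = normal_part ?F x L"
    by (simp add: mean_curvature_vector_def second_fundamental_form_def inverse_metric_def induced_metric_eq_gram
        L_def linear_sum[OF lin] linear_cmul[OF lin] partial_deriv_jac[OF \<open>open D\<close> F x])
  then have "normal_part ?F x L = 0" using min x by (simp add: minimal_on_def)
  then have L_eq: "L = (\<Sum>i\<in>UNIV. c i *\<^sub>R ?X $ i)" by (simp add: np c_def)
  then have "fst L = (\<Sum>i\<in>UNIV. c i *\<^sub>R axis i 1)"
    by (simp add: fst_sum partial_deriv_graph_map[OF fx[OF x]])
  also have "\<dots> = (\<chi> i. c i)"
    using basis_expansion[of "\<chi> i. c i"] by (simp add: scalar_mult_eq_scaleR)
  finally have "c i = 0" for i using fstL by (simp add: vec_eq_iff)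
  then show "L = 0" using L_eq by simp
qed

section \<open>Tangential variations\<close>

text \<open>Infinitesimal invariance under the reparametrizations generated by
  \<open>\<tau>\<close>. The frame \<open>jac T\<close> is the derivative of \<open>jac F\<close>
  along \<open>\<tau>\<close> plus a change of frame by the matrix \<open>B\<close> of derivatives
  of \<open>\<tau>\<close>; the chain rule and the equivariance of \<open>flux\<close> express the
  Hessian by \<open>C\<close> and its derivatives. On the other side \<open>Z\<close> is the
  derivative of \<open>Y\<close> along \<open>\<tau>\<close>: subtracting
  \<open>C x $ k \<bullet> Z x\<close> removes the second derivatives of \<open>Y\<close>, and
  \<open>div\<close> kills the remaining term.\<close>

lemma flux_deriv_tangential_divergence:
  fixes F Y :: "real ^ 'n \<Rightarrow> 'a::euclidean_space" and \<tau> :: "real ^ 'n \<Rightarrow> real ^ 'n"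
  assumes "open D" and F: "diff_times_on 3 D F" and Y: "diff_times_on 2 D Y" and \<tau>: "diff_times_on 1 D \<tau>"
    and x: "x \<in> D" and det: "\<And>x. x \<in> D \<Longrightarrow> det (gram (jac F x)) > 0"
    and div: "(\<Sum>k\<in>UNIV. flux_deriv (jac F x) (partial_deriv (jac F) k x) $ k) = 0"
  defines "T \<equiv> \<lambda>x. \<Sum>k\<in>UNIV. \<tau> x $ k *\<^sub>R partial_deriv F k x"
    and "Z \<equiv> \<lambda>x. \<Sum>k\<in>UNIV. \<tau> x $ k *\<^sub>R partial_deriv Y k x"
    and "C \<equiv> \<lambda>x. flux (jac F x)"
  shows "flux_deriv (jac F x) (jac T x) \<bullet> jac Y x
    = (\<Sum>k\<in>UNIV. partial_deriv (\<lambda>x. \<tau> x $ k * (C x \<bullet> jac Y x) - C x $ k \<bullet> Z x) k x)"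
proof -
  have F2: "diff_times_on 2 D F" using F diff_times_on_lower[of 2 D F] by (simp add: numeral_3_eq_3 numeral_2_eq_2)
  have d1: "diff_times_on 1 D g \<Longrightarrow> g differentiable at x" for g :: "real ^ 'n \<Rightarrow> 'z::real_normed_vector"
    using x by simp
  have dF: "partial_deriv F k differentiable at x" for k
    by (rule d1[OF diff_times_on_partial_deriv]) (use F2 in \<open>simp add: numeral_2_eq_2\<close>)
  have dY: "partial_deriv Y k differentiable at x" for k
    by (rule d1[OF diff_times_on_partial_deriv]) (use Y in \<open>simp add: numeral_2_eq_2\<close>)
  have d\<tau>: "(\<lambda>x. \<tau> x $ k) differentiable at x" for k
    by (rule d1[OF diff_times_on_bounded_linear_compose[OF bounded_linear_vec_nth \<open>open D\<close> \<tau>]])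
  have \<tau>k: "partial_deriv (\<lambda>x. \<tau> x $ k) i x = partial_deriv \<tau> i x $ k" for i k
    by (rule partial_deriv_bounded_linear[OF bounded_linear_vec_nth d1[OF \<tau>]])
  have jF1: "diff_times_on 1 D (jac F)"
    by (rule diff_times_on_jac[OF \<open>open D\<close>]) (use F2 in \<open>simp add: numeral_2_eq_2\<close>)
  have jY1: "diff_times_on 1 D (jac Y)"
    by (rule diff_times_on_jac[OF \<open>open D\<close>]) (use Y in \<open>simp add: numeral_2_eq_2\<close>)
  have C1: "diff_times_on 1 D C"
    unfolding C_def by (rule diff_times_on_flux[OF \<open>open D\<close> jF1 det])
  note jF = d1[OF jF1] and jY = d1[OF jY1] and dC = d1[OF C1]
  have dCk: "(\<lambda>x. C x $ k) differentiable at x" for k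
    by (rule d1[OF diff_times_on_bounded_linear_compose[OF bounded_linear_vec_nth \<open>open D\<close> C1]])
  have \<tau>Yk: "(\<lambda>x. \<tau> x $ k *\<^sub>R partial_deriv Y k x) differentiable at x" for k
    using d\<tau> dY by (rule differentiable_scaleR)
  have dZ: "Z differentiable at x"
    unfolding Z_def by (intro differentiable_sum ballI \<tau>Yk) auto
  have \<tau>Fk: "(\<lambda>x. \<tau> x $ k *\<^sub>R partial_deriv F k x) differentiable at x" for k
    using d\<tau> dF by (rule differentiable_scaleR)
  have CjY: "(\<lambda>x. C x \<bullet> jac Y x) differentiable at x"
    using dC jY by (rule differentiable_inner)

  define dCx where "dCx k = flux_deriv (jac F x) (partial_deriv (jac F) k x)" for k
  have pC: "partial_deriv C k x = dCx k" for k
    unfolding C_def dCx_def by (rule partial_deriv_flux_jac[OF jF det[OF x]])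
  have pCk: "partial_deriv (\<lambda>x. C x $ k) i x = dCx i $ k" for i k
    unfolding pC[symmetric] by (rule partial_deriv_bounded_linear[OF bounded_linear_vec_nth dC])
  have Tsum: "partial_deriv T i x = (\<Sum>k\<in>UNIV. \<tau> x $ k *\<^sub>R partial_deriv (partial_deriv F k) i x
      + partial_deriv \<tau> i x $ k *\<^sub>R partial_deriv F k x)" for i
    unfolding T_def
    by (simp add: partial_deriv_sum \<tau>Fk partial_deriv_bilinear[OF bounded_bilinear_scaleR d\<tau> dF] \<tau>k)
  have Zsum: "partial_deriv Z i x = (\<Sum>k\<in>UNIV. \<tau> x $ k *\<^sub>R partial_deriv (partial_deriv Y k) i x
      + partial_deriv \<tau> i x $ k *\<^sub>R partial_deriv Y k x)" for i
    unfolding Z_def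
    by (simp add: partial_deriv_sum \<tau>Yk partial_deriv_bilinear[OF bounded_bilinear_scaleR d\<tau> dY] \<tau>k)

  define B :: "real^'n^'n" where "B = (\<chi> i k. partial_deriv \<tau> i x $ k)"
  have jT: "jac T x = (\<Sum>k\<in>UNIV. \<tau> x $ k *\<^sub>R partial_deriv (jac F) k x) + row_comb B (jac F x)"
    by (simp add: vec_eq_iff Tsum row_comb_def B_def partial_deriv_jac[OF \<open>open D\<close> F2 x]
        partial_deriv_symmetric[OF \<open>open D\<close> F2 x] sum.distrib)
  have "flux_deriv (jac F x) (jac T x) = (\<Sum>k\<in>UNIV. \<tau> x $ k *\<^sub>R dCx k)
      + trace B *\<^sub>R C x - row_comb (transpose B) (C x)"
    unfolding jT linear_add[OF linear_flux_deriv] linear_sum[OF linear_flux_deriv] linear_cmul[OF linear_flux_deriv]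
    using det[OF x] by (simp add: flux_deriv_row_comb dCx_def C_def)
  then have lhs: "flux_deriv (jac F x) (jac T x) \<bullet> jac Y x
      = (\<Sum>k\<in>UNIV. \<tau> x $ k * (dCx k \<bullet> jac Y x)) + trace B * (C x \<bullet> jac Y x)
        - row_comb (transpose B) (C x) \<bullet> jac Y x"
    by (simp add: inner_diff_left inner_add_left inner_sum_left)

  have "partial_deriv (\<lambda>x. \<tau> x $ k * (C x \<bullet> jac Y x) - C x $ k \<bullet> Z x) k x
      = \<tau> x $ k * (C x \<bullet> partial_deriv (jac Y) k x + dCx k \<bullet> jac Y x) + B $ k $ k * (C x \<bullet> jac Y x)
        - (C x $ k \<bullet> partial_deriv Z k x + dCx k $ k \<bullet> Z x)" for k
    by (subst partial_deriv_diff)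
      (simp_all add: differentiable_mult differentiable_inner d\<tau> CjY dCk dZ
        partial_deriv_bilinear[OF bounded_bilinear_mult d\<tau> CjY]
        partial_deriv_bilinear[OF bounded_bilinear_inner dC jY] pC \<tau>k B_def
        partial_deriv_bilinear[OF bounded_bilinear_inner dCk dZ] pCk)
  then have rhs: "(\<Sum>k\<in>UNIV. partial_deriv (\<lambda>x. \<tau> x $ k * (C x \<bullet> jac Y x) - C x $ k \<bullet> Z x) k x)
      = (\<Sum>k\<in>UNIV. \<tau> x $ k * (C x \<bullet> partial_deriv (jac Y) k x)) + (\<Sum>k\<in>UNIV. \<tau> x $ k * (dCx k \<bullet> jac Y x))
        + trace B * (C x \<bullet> jac Y x) - (\<Sum>k\<in>UNIV. C x $ k \<bullet> partial_deriv Z k x) - (\<Sum>k\<in>UNIV. dCx k $ k) \<bullet> Z x"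
    by (simp add: sum.distrib sum_subtractf distrib_left trace_def sum_distrib_right inner_sum_left)
  have "(\<Sum>k\<in>UNIV. C x $ k \<bullet> partial_deriv Z k x)
      = (\<Sum>k\<in>UNIV. \<Sum>i\<in>UNIV. \<tau> x $ i * (C x $ k \<bullet> partial_deriv (partial_deriv Y i) k x))
        + (\<Sum>k\<in>UNIV. \<Sum>i\<in>UNIV. B $ k $ i * (C x $ k \<bullet> partial_deriv Y i x))"
    by (simp add: Zsum inner_sum_right inner_add_right sum.distrib B_def)
  also have "(\<Sum>k\<in>UNIV. \<Sum>i\<in>UNIV. \<tau> x $ i * (C x $ k \<bullet> partial_deriv (partial_deriv Y i) k x))
      = (\<Sum>k\<in>UNIV. \<tau> x $ k * (C x \<bullet> partial_deriv (jac Y) k x))"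
    by (subst sum.swap) (simp add: inner_vec_def sum_distrib_left partial_deriv_jac[OF \<open>open D\<close> Y x]
        partial_deriv_symmetric[OF \<open>open D\<close> Y x])
  also have "(\<Sum>k\<in>UNIV. \<Sum>i\<in>UNIV. B $ k $ i * (C x $ k \<bullet> partial_deriv Y i x))
      = row_comb (transpose B) (C x) \<bullet> jac Y x"
    by (subst sum.swap) (simp add: inner_vec_def row_comb_def transpose_def inner_sum_left)
  finally show ?thesis
    using div by (simp add: lhs rhs flip: dCx_def)
qed

lemma set_integrable_compact_continuous:
  fixes g :: "'a::euclidean_space \<Rightarrow> real"
  assumes "compact K" "continuous_on K g"
  shows "set_integrable lborel K g"
  unfolding set_integrable_def by (rule borel_integrable_compact[OF assms])

text \<open>The components \<open>h k\<close> of the divergence are linear in \<open>Y\<close> and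
  its first derivatives, so they vanish off \<open>K\<close> and each integrates to zero.\<close>

lemma integral_flux_deriv_tangential_eq_0:
  fixes F Y :: "real ^ 'n \<Rightarrow> 'a::euclidean_space" and \<tau> :: "real ^ 'n \<Rightarrow> real ^ 'n"
  assumes D: "open D" and F: "diff_times_on 3 D F" and Y: "diff_times_on 2 D Y" and \<tau>: "diff_times_on 1 D \<tau>"
    and det: "\<And>x. x \<in> D \<Longrightarrow> det (gram (jac F x)) > 0"
    and div: "\<And>x. x \<in> D \<Longrightarrow> (\<Sum>k\<in>UNIV. flux_deriv (jac F x) (partial_deriv (jac F) k x) $ k) = 0"
    and K: "compact K" "K \<subseteq> D" and Y0: "\<And>x. x \<in> D - K \<Longrightarrow> Y x = 0"
  shows "(LINT x:K|lborel. flux_deriv (jac F x) (jac (\<lambda>x. \<Sum>k\<in>UNIV. \<tau> x $ k *\<^sub>R partial_deriv F k x) x) \<bullet> jac Y x) = 0"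
proof -
  define C where "C x = flux (jac F x)" for x
  define Z where "Z x = (\<Sum>k\<in>UNIV. \<tau> x $ k *\<^sub>R partial_deriv Y k x)" for x
  define h where "h k x = \<tau> x $ k * (C x \<bullet> jac Y x) - C x $ k \<bullet> Z x" for k x
  have Y': "partial_deriv Y k x = 0" if "x \<in> D - K" for k x
    unfolding partial_deriv_def
    by (rule frechet_derivative_eq_0_off[OF D compact_imp_closed[OF K(1)] Y0 that])
  have h0: "h k x = 0" if "x \<in> D - K" for k x
    using Y'[OF that] by (simp add: h_def Z_def inner_vec_def)
  have jF1: "diff_times_on 1 D (jac F)"
    using diff_times_on_lower[of 1 D "jac F"] diff_times_on_jac[OF D, of 2 F] F
    by (simp add: numeral_3_eq_3 numeral_2_eq_2)
  have jY1: "diff_times_on 1 D (jac Y)"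
    by (rule diff_times_on_jac[OF D]) (use Y in \<open>simp add: numeral_2_eq_2\<close>)
  have pY1: "diff_times_on 1 D (partial_deriv Y k)" for k
    by (rule diff_times_on_partial_deriv) (use Y in \<open>simp add: numeral_2_eq_2\<close>)
  have C1: "diff_times_on 1 D C"
    unfolding C_def[abs_def] by (rule diff_times_on_flux[OF D jF1 det])
  have \<tau>1: "diff_times_on 1 D (\<lambda>x. \<tau> x $ k)" for k
    by (rule diff_times_on_bounded_linear_compose[OF bounded_linear_vec_nth D \<tau>])
  have Z1: "diff_times_on 1 D Z"
    unfolding Z_def[abs_def]
    by (rule diff_times_on_sum[OF D finite diff_times_on_bilinear[OF bounded_bilinear_scaleR D \<tau>1 pY1]])
  have h1: "diff_times_on 1 D (h k)" for k
  proof -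
    have "diff_times_on 1 D (\<lambda>x. \<tau> x $ k * (C x \<bullet> jac Y x) + - (C x $ k \<bullet> Z x))"
      by (rule diff_times_on_add[OF D diff_times_on_bilinear[OF bounded_bilinear_mult D \<tau>1
            diff_times_on_bilinear[OF bounded_bilinear_inner D C1 jY1]]
          diff_times_on_bounded_linear_compose[OF bounded_linear_minus[OF bounded_linear_ident] D
            diff_times_on_bilinear[OF bounded_bilinear_inner D
              diff_times_on_bounded_linear_compose[OF bounded_linear_vec_nth D C1] Z1]]])
    then show ?thesis by (simp add: h_def[abs_def])
  qed
  have int: "set_integrable lborel K (partial_deriv (h k) k)" for k
    by (rule set_integrable_compact_continuous[OF K(1) continuous_on_subset[OF _ K(2)]])
      (use diff_times_on_partial_deriv[of 0 D "h k"] h1 in simp)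
  have "(LINT x:K|lborel. flux_deriv (jac F x) (jac (\<lambda>x. \<Sum>k\<in>UNIV. \<tau> x $ k *\<^sub>R partial_deriv F k x) x) \<bullet> jac Y x)
      = (LINT x:K|lborel. \<Sum>k\<in>UNIV. partial_deriv (h k) k x)"
  proof (rule set_lebesgue_integral_cong)
    show "\<forall>x. x \<in> K \<longrightarrow> flux_deriv (jac F x) (jac (\<lambda>x. \<Sum>k\<in>UNIV. \<tau> x $ k *\<^sub>R partial_deriv F k x) x) \<bullet> jac Y x
        = (\<Sum>k\<in>UNIV. partial_deriv (h k) k x)"
    proof (intro allI impI)
      fix x assume "x \<in> K"
      with K have x: "x \<in> D" by blast
      show "flux_deriv (jac F x) (jac (\<lambda>x. \<Sum>k\<in>UNIV. \<tau> x $ k *\<^sub>R partial_deriv F k x) x) \<bullet> jac Y x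
        = (\<Sum>k\<in>UNIV. partial_deriv (h k) k x)"
        unfolding h_def[abs_def] C_def[abs_def] Z_def[abs_def]
        by (rule flux_deriv_tangential_divergence[OF D F Y \<tau> x det div[OF x]])
    qed
  qed (use K(1) in \<open>simp add: borel_compact\<close>)
  also have "\<dots> = (\<Sum>k\<in>UNIV. LINT x:K|lborel. partial_deriv (h k) k x)"
    using int unfolding set_lebesgue_integral_def set_integrable_def scaleR_sum_right
    by (rule Bochner_Integration.integral_sum)
  also have "\<dots> = 0"
    unfolding partial_deriv_def
    by (intro sum.neutral ballI integral_compact_support_derivative_eq_0[OF D h1 K h0])
  finally show ?thesis .
qed

section \<open>Stability\<close>

lemma stability_const_pos: "stability_const n m > 0"
  by (auto simp: stability_const_def)

text \<open>With s = sqrt(1 + c) the fraction equals (s + 1) / (2 s) = 1/2 + 1/(2 s).\<close>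

lemma half_le_star_Omega_bound:
  fixes c :: real
  assumes "c > 0"
  shows "1 / 2 \<le> c / (2 * (c + 1 - sqrt (1 + c)))"
proof -
  have 1: "sqrt (1 + c) \<ge> 1" using assms by simp
  have "sqrt (1 + c) * 1 < sqrt (1 + c) * sqrt (1 + c)"
    using assms by (intro mult_strict_left_mono) auto
  then have "c + 1 - sqrt (1 + c) > 0" using assms by simp
  then show ?thesis using 1 by (simp add: field_simps)
qed

lemma gram_jac_graph_map_eq:
  fixes f :: "real ^ 'n \<Rightarrow> real ^ 'm"
  assumes "f differentiable at x"
  shows "gram (jac (graph_map f) x) = mat 1 + transpose (jacobian f (at x)) ** jacobian f (at x)"
proof -
  have "gram (jac (graph_map f) x) $ i $ j = (if i = j then 1 else 0) + partial_deriv f i x \<bullet> partial_deriv f j x"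
    for i j
    by (simp add: gram_def partial_deriv_graph_map[OF assms] inner_prod_def inner_axis_axis)
  then show ?thesis
    by (simp add: vec_eq_iff mat_def jacobian_def matrix_def partial_deriv_def matrix_matrix_mult_def
        transpose_def inner_vec_def)
qed

lemma det_gram_le_4_of_star_Omega:
  fixes f :: "real ^ 'n \<Rightarrow> real ^ 'm"
  assumes f: "f differentiable at x" and star: "star_Omega f x \<ge> 1 / 2"
  shows "det (gram (jac (graph_map f) x)) \<le> 4"
proof -
  let ?d = "det (gram (jac (graph_map f) x))"
  have "?d \<ge> 1" by (rule det_gram_graph_ge_1[OF gram_jac_graph_map[OF f]])
  then have "sqrt ?d \<le> 2"
    using star by (simp add: star_Omega_def field_simps flip: gram_jac_graph_map_eq[OF f])
  from power_mono[OF this, of 2] \<open>?d \<ge> 1\<close> show ?thesis by simp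
qed

text \<open>By uniform continuity on a compact product, a small \<open>t\<close> changes the
  determinant by less than 1, which is its lower bound at \<open>t = 0\<close>. Hence one interval
  of \<open>t\<close> serves all of \<open>K\<close>.\<close>

lemma gram_det_pos_perturbation:
  fixes X Y :: "'c::metric_space \<Rightarrow> 'a::euclidean_space^'n"
  assumes K: "compact K" and X: "continuous_on K X" and Y: "continuous_on K Y"
    and det: "\<And>x. x \<in> K \<Longrightarrow> det (gram (X x)) \<ge> 1"
  obtains d where "d > 0" "\<And>t x. t \<in> {-d..d} \<Longrightarrow> x \<in> K \<Longrightarrow> det (gram (X x + t *\<^sub>R Y x)) > 0"
proof -
  let ?g = "\<lambda>p. det (gram (X (snd p) + fst p *\<^sub>R Y (snd p)))"
  have X': "continuous_on ({-1..1::real} \<times> K) (\<lambda>p. X (snd p))"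
    and Y': "continuous_on ({-1..1::real} \<times> K) (\<lambda>p. Y (snd p))"
    by (auto intro!: continuous_on_compose2[OF X] continuous_on_compose2[OF Y] continuous_intros)
  have "continuous_on ({-1..1} \<times> K) ?g"
    unfolding gram_eq_symgram
    by (intro continuous_on_compose2[OF continuous_det[of UNIV]] bounded_bilinear.continuous_on[OF bounded_bilinear_symgram]
        continuous_intros X' Y') auto
  then have "uniformly_continuous_on ({-1..1} \<times> K) ?g"
    by (intro compact_uniformly_continuous compact_Times K) auto
  from uniformly_continuous_onE[OF this zero_less_one] obtain e where e: "e > 0"
    "\<And>p q. p \<in> {-1..1} \<times> K \<Longrightarrow> q \<in> {-1..1} \<times> K \<Longrightarrow> dist q p < e \<Longrightarrow> dist (?g q) (?g p) < 1"
    by metis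
  \<comment> \<open>The 1 keeps \<open>t\<close> in the interval of uniform continuity; the half
    turns \<open>|t| \<le> d\<close> into a distance strictly below \<open>e\<close>.\<close>
  define d where "d = min 1 (e / 2)"
  have "det (gram (X x + t *\<^sub>R Y x)) > 0" if "t \<in> {-d..d}" "x \<in> K" for t x
  proof -
    have "dist (?g (t, x)) (?g (0, x)) < 1"
      using that e(1) by (intro e(2)) (auto simp: d_def dist_Pair_Pair dist_real_def)
    then show ?thesis using det[OF \<open>x \<in> K\<close>] by (simp add: dist_real_def)
  qed
  moreover have "d > 0" using e by (simp add: d_def)
  ultimately show thesis using that by blast
qed

text \<open>The frame moves along a straight line with velocity \<open>Y\<close>, so the second
  derivative of the density is the Hessian alone, without an acceleration term.\<close>

lemma volume_variation_derivatives:
  fixes X Y :: "'c::euclidean_space \<Rightarrow> 'a::euclidean_space^'n"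
  assumes K: "compact K" and X: "continuous_on K X" and Y: "continuous_on K Y"
    and det: "\<And>x. x \<in> K \<Longrightarrow> det (gram (X x)) \<ge> 1"
  defines "A \<equiv> \<lambda>t. LINT x:K|lborel. flux (X x + t *\<^sub>R Y x) \<bullet> Y x"
  shows "\<forall>\<^sub>F t in nhds 0. ((\<lambda>t. LINT x:K|lborel. vol (X x + t *\<^sub>R Y x)) has_real_derivative A t) (at t)"
    and "(A has_real_derivative (LINT x:K|lborel. flux_deriv (X x) (Y x) \<bullet> Y x)) (at 0)"
proof -
  obtain d where d: "d > 0" "\<And>t x. t \<in> {-d..d} \<Longrightarrow> x \<in> K \<Longrightarrow> det (gram (X x + t *\<^sub>R Y x)) > 0"
    using gram_det_pos_perturbation[OF K X Y det] by blast
  have line: "((\<lambda>t. X x + t *\<^sub>R Y x) has_derivative (\<lambda>h. h *\<^sub>R Y x)) (at t)" for t x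
    by (auto intro!: derivative_eq_intros)
  have vol': "((\<lambda>t. vol (X x + t *\<^sub>R Y x)) has_real_derivative flux (X x + t *\<^sub>R Y x) \<bullet> Y x) (at t)"
    if "t \<in> {-d..d}" "x \<in> K" for t x
    using has_real_derivative_along_line[OF vol_has_derivative[OF d(2)[OF that]]] .
  have flux': "((\<lambda>t. flux (X x + t *\<^sub>R Y x) \<bullet> Y x) has_real_derivative
      flux_deriv (X x + t *\<^sub>R Y x) (Y x) \<bullet> Y x) (at t)"
    if "t \<in> {-d..d}" "x \<in> K" for t x
    using has_real_derivative_along_line[OF has_derivative_inner_left[OF flux_has_derivative[OF d(2)[OF that]]]] .
  have X': "continuous_on ({-d..d} \<times> K) (\<lambda>p. X (snd p))"
    and Y': "continuous_on ({-d..d} \<times> K) (\<lambda>p. Y (snd p))"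
    by (auto intro!: continuous_on_compose2[OF X] continuous_on_compose2[OF Y] continuous_intros)
  have XY: "continuous_on ({-d..d} \<times> K) (\<lambda>p. X (snd p) + fst p *\<^sub>R Y (snd p))"
    by (intro continuous_intros X' Y')
  have on_image: "continuous_on ({-d..d} \<times> K) (\<lambda>p. g (X (snd p) + fst p *\<^sub>R Y (snd p)))"
    if "\<And>Z. det (gram Z) > 0 \<Longrightarrow> isCont g Z" for g :: "'a^'n \<Rightarrow> 'z::real_normed_vector"
    by (rule continuous_on_compose2[OF _ XY subset_refl])
      (use d(2) in \<open>auto intro!: continuous_at_imp_continuous_on that\<close>)
  have flux_c: "continuous_on ({-d..d} \<times> K) (\<lambda>p. flux (X (snd p) + fst p *\<^sub>R Y (snd p)) \<bullet> Y (snd p))"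
    by (intro continuous_on_inner on_image Y' has_derivative_continuous[OF flux_has_derivative])
  have flux_deriv_c: "continuous_on ({-d..d} \<times> K)
      (\<lambda>p. flux_deriv (X (snd p) + fst p *\<^sub>R Y (snd p)) (Y (snd p)) \<bullet> Y (snd p))"
    using d(2) by (intro continuous_on_inner continuous_on_flux_deriv XY Y') auto
  have vol_c: "continuous_on ({-d..d} \<times> K) (\<lambda>p. vol (X (snd p) + fst p *\<^sub>R Y (snd p)))"
    by (intro on_image has_derivative_continuous[OF vol_has_derivative])
  have section_c: "continuous_on K (\<lambda>x. g (t, x))"
    if "continuous_on ({-d..d} \<times> K) g" "t \<in> {-d..d}" for g :: "real \<times> 'c \<Rightarrow> real" and t
    by (rule continuous_on_compose2[OF that(1)]) (use that(2) in \<open>auto intro!: continuous_intros\<close>)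
  have "((\<lambda>t. LINT x:K|lborel. vol (X x + t *\<^sub>R Y x)) has_real_derivative A t) (at t)"
    if "t \<in> {-d<..<d}" for t
    unfolding A_def
    by (rule set_integral_compact_has_real_derivative[OF K that vol'])
      (use section_c[OF vol_c] flux_c in \<open>auto simp: case_prod_unfold\<close>)
  then show "\<forall>\<^sub>F t in nhds 0. ((\<lambda>t. LINT x:K|lborel. vol (X x + t *\<^sub>R Y x)) has_real_derivative A t) (at t)"
    using d(1) by (intro eventually_nhds_in_open[of "{-d<..<d}", THEN eventually_mono]) auto
  have "(A has_real_derivative (LINT x:K|lborel. flux_deriv (X x + 0 *\<^sub>R Y x) (Y x) \<bullet> Y x)) (at 0)"
    unfolding A_def
    by (rule set_integral_compact_has_real_derivative[OF K _ flux', where a = "-d" and b = d])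
      (use d(1) section_c[OF flux_c] flux_deriv_c in \<open>auto simp: case_prod_unfold\<close>)
  then show "(A has_real_derivative (LINT x:K|lborel. flux_deriv (X x) (Y x) \<bullet> Y x)) (at 0)"
    by simp
qed

lemma second_variation_graph_nonneg:
  fixes f :: "real ^ 'n \<Rightarrow> real ^ 'm" and V :: "real ^ 'n \<Rightarrow> (real ^ 'n) \<times> (real ^ 'm)"
  assumes D: "open D" and f: "smooth_on D f" and min: "minimal_on D (graph_map f)"
    and det4: "\<And>x. x \<in> D \<Longrightarrow> det (gram (jac (graph_map f) x)) \<le> 4"
    and V: "smooth_on D V" and K: "compact K" "K \<subseteq> D" and V0: "\<And>x. x \<in> D - K \<Longrightarrow> V x = 0"
  shows "0 \<le> (LINT x:K|lborel. flux_deriv (jac (graph_map f) x) (jac V x) \<bullet> jac V x)"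
proof -
  let ?F = "graph_map f"
  have fk: "diff_times_on k D f" and Vk: "diff_times_on k D V" for k
    using f V by (auto simp: smooth_on_def)
  have Fk: "diff_times_on k D ?F" for k by (intro diff_times_on_graph_map D fk)
  have fd: "f differentiable at x" if "x \<in> D" for x
    using fk[of 1] that by simp
  have hor: "fst (jac ?F x $ i) \<bullet> fst (jac ?F x $ j) = (if i = j then 1 else 0)" if "x \<in> D" for x i j
    by (rule gram_jac_graph_map[OF fd[OF that]])
  have det1: "det (gram (jac ?F x)) \<ge> 1" if "x \<in> D" for x
    by (rule det_gram_graph_ge_1[OF hor[OF that]])
  then have det: "det (gram (jac ?F x)) > 0" if "x \<in> D" for x
    using that by fastforce
  have div: "(\<Sum>k\<in>UNIV. flux_deriv (jac ?F x) (partial_deriv (jac ?F) k x) $ k) = 0" if "x \<in> D" for x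
    by (rule minimal_graph_flux_divergence_eq_0[OF D fk min that])
  define \<tau> where "\<tau> x = fst (V x)" for x
  define T where "T x = (\<Sum>k\<in>UNIV. \<tau> x $ k *\<^sub>R partial_deriv ?F k x)" for x
  define W where "W x = V x - T x" for x
  \<comment> \<open>Equals \<open>2 W + T\<close>. By symmetry of the Hessian, pairing
    \<open>T\<close> with \<open>Y\<close> collects both mixed terms of \<open>V = W + T\<close> and
    the purely tangential one.\<close>
  define Y where "Y x = 2 *\<^sub>R V x - T x" for x
  have \<tau>k: "diff_times_on k D \<tau>" for k
    unfolding \<tau>_def[abs_def] by (rule diff_times_on_bounded_linear_compose[OF bounded_linear_fst D Vk])
  have Tk: "diff_times_on k D T" for k
    unfolding T_def[abs_def]
    by (rule diff_times_on_sum[OF D finite diff_times_on_bilinear[OF bounded_bilinear_scaleR D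
          diff_times_on_bounded_linear_compose[OF bounded_linear_vec_nth D \<tau>k] diff_times_on_partial_deriv[OF Fk]]])
  have Yk: "diff_times_on k D Y" for k
  proof -
    have "diff_times_on k D (\<lambda>x. 2 *\<^sub>R V x + - T x)"
      by (rule diff_times_on_add[OF D
            diff_times_on_bounded_linear_compose[OF bounded_linear_scaleR_right D Vk]
            diff_times_on_bounded_linear_compose[OF bounded_linear_minus[OF bounded_linear_ident] D Tk]])
    then show ?thesis by (simp add: Y_def[abs_def])
  qed
  have Vd: "V differentiable at x" and Td: "T differentiable at x" if "x \<in> D" for x
    using Vk[of 1] Tk[of 1] that by simp_all
  have jW: "jac W x = jac V x - jac T x" if "x \<in> D" for x
    unfolding W_def[abs_def] by (simp add: vec_eq_iff partial_deriv_diff Vd[OF that] Td[OF that])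
  have jY: "jac Y x = 2 *\<^sub>R jac V x - jac T x" if "x \<in> D" for x
  proof -
    have "(\<lambda>x. 2 *\<^sub>R V x) differentiable at x" using Vd[OF that] by simp
    then show ?thesis
      unfolding Y_def[abs_def]
      by (simp add: vec_eq_iff partial_deriv_diff Vd[OF that] Td[OF that]
          partial_deriv_bounded_linear[OF bounded_linear_scaleR_right])
  qed
  have fst_W: "fst (W x) = 0" if "x \<in> D" for x
  proof -
    have "fst (T x) = (\<Sum>k\<in>UNIV. \<tau> x $ k *\<^sub>R axis k 1)"
      by (simp add: T_def fst_sum partial_deriv_graph_map[OF fd[OF that]])
    also have "\<dots> = \<tau> x"
      using basis_expansion[of "\<tau> x"] by (simp add: scalar_mult_eq_scaleR)
    finally show ?thesis by (simp add: W_def \<tau>_def)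
  qed
  have vert: "fst (jac W x $ i) = 0" if "x \<in> D" for x i
  proof -
    have "W differentiable at x"
      unfolding W_def[abs_def] using Vd[OF that] Td[OF that] by (rule differentiable_diff)
    then have "fst (partial_deriv W i x) = partial_deriv (\<lambda>x. fst (W x)) i x"
      by (rule partial_deriv_bounded_linear[OF bounded_linear_fst, symmetric])
    also have "\<dots> = 0"
      unfolding partial_deriv_def
      \<comment> \<open>The horizontal part of \<open>W\<close> vanishes on all of \<open>D\<close>,
        so the exceptional closed set is empty.\<close>
      using frechet_derivative_eq_0_off[of D "{}" "\<lambda>x. fst (W x)" x] D fst_W that by simp
    finally show ?thesis by simp
  qed
  let ?M = "\<lambda>Z Z' x. flux_deriv (jac ?F x) (jac Z x) \<bullet> jac Z' x"
  have split: "?M V V x = ?M W W x + ?M T Y x" if "x \<in> D" for x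
  proof -
    have V_eq: "jac V x = jac W x + jac T x" and Y_eq: "jac Y x = 2 *\<^sub>R jac W x + jac T x"
      by (simp_all add: jW[OF that] jY[OF that] algebra_simps scaleR_2)
    have "?M W T x = ?M T W x"
      using det[OF that] by (intro flux_deriv_symmetric) simp
    then show ?thesis
      unfolding V_eq Y_eq linear_add[OF linear_flux_deriv]
      by (simp add: inner_add_left inner_add_right)
  qed
  have cont: "continuous_on K (?M Z Z')" if "\<And>k. diff_times_on k D Z" "\<And>k. diff_times_on k D Z'" for Z Z'
    using det K that(1)[of 1] that(2)[of 1] Fk[of 1]
      diff_times_on_jac[OF D, of 0 ?F] diff_times_on_jac[OF D, of 0 Z] diff_times_on_jac[OF D, of 0 Z']
    by (intro continuous_on_subset[OF _ K(2)] continuous_on_inner continuous_on_flux_deriv) simp_all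
  have Wk: "diff_times_on k D W" for k
  proof -
    have "diff_times_on k D (\<lambda>x. V x + - T x)"
      by (rule diff_times_on_add[OF D Vk
            diff_times_on_bounded_linear_compose[OF bounded_linear_minus[OF bounded_linear_ident] D Tk]])
    then show ?thesis by (simp add: W_def[abs_def])
  qed
  have "(LINT x:K|lborel. ?M V V x) = (LINT x:K|lborel. ?M W W x + ?M T Y x)"
    using split K by (intro set_lebesgue_integral_cong) (auto simp: borel_compact)
  also have "\<dots> = (LINT x:K|lborel. ?M W W x) + (LINT x:K|lborel. ?M T Y x)"
    by (intro set_integral_add set_integrable_compact_continuous K cont Wk Tk Yk)
  also have "(LINT x:K|lborel. ?M T Y x) = 0"
  proof -
    have "Y x = 0" if "x \<in> D - K" for x
      using V0[OF that] by (simp add: Y_def T_def \<tau>_def)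
    from integral_flux_deriv_tangential_eq_0[OF D Fk Yk \<tau>k det div K this]
    show ?thesis unfolding T_def[abs_def] .
  qed
  finally have "(LINT x:K|lborel. ?M V V x) = (LINT x:K|lborel. ?M W W x)" by simp
  also have "\<dots> \<ge> 0"
    unfolding set_lebesgue_integral_def
  proof (intro integral_nonneg_AE AE_I2)
    fix x
    have "?M W W x \<ge> 0" if "x \<in> K"
      using that K by (intro flux_deriv_vertical_nonneg hor vert det4) auto
    then show "0 \<le> indicator K x *\<^sub>R ?M W W x" by (simp add: indicator_def)
  qed
  finally show ?thesis .
qed

theorem mainTheorem2:
  fixes D :: "(real ^ 'n) set"
    and f :: "real ^ 'n \<Rightarrow> real ^ 'm"
    and c :: real
  assumes "open D" and "connected D"
    and "smooth_on D f"
    and "c = stability_const CARD('n) CARD('m)"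
    and "minimal_on D (graph_map f)"
    and "\<forall>x\<in>D. star_Omega f x \<ge> c / (2 * (c + 1 - sqrt (1 + c)))"
  shows "stable_on D (graph_map f)"
  unfolding stable_on_def
proof (intro allI impI, elim conjE)
  let ?F = "graph_map f"
  fix V :: "real ^ 'n \<Rightarrow> (real ^ 'n) \<times> (real ^ 'm)" and K
  assume V: "smooth_on D V" and K: "compact K" "K \<subseteq> D" and V0: "\<forall>x\<in>D - K. V x = 0"
  have fd: "f differentiable at x" if "x \<in> D" for x
    using assms(3) that diff_times_on_imp_differentiable[of 0 D f] unfolding smooth_on_def by blast
  have half: "1 / 2 \<le> c / (2 * (c + 1 - sqrt (1 + c)))"
    unfolding assms(4) by (rule half_le_star_Omega_bound[OF stability_const_pos])
  have star: "star_Omega f x \<ge> 1 / 2" if "x \<in> D" for x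
    by (rule order_trans[OF half bspec[OF assms(6) that]])
  have det4: "det (gram (jac ?F x)) \<le> 4" if "x \<in> D" for x
    by (rule det_gram_le_4_of_star_Omega[OF fd[OF that] star[OF that]])
  have det1: "det (gram (jac ?F x)) \<ge> 1" if "x \<in> K" for x
    using that K by (intro det_gram_graph_ge_1 gram_jac_graph_map fd) auto
  have Fk: "diff_times_on k D ?F" and Vk: "diff_times_on k D V" for k
    using assms(1,3) V by (auto simp: smooth_on_def intro: diff_times_on_graph_map)
  have jac_c: "continuous_on K (jac Z)" if "diff_times_on 1 D Z" for Z :: "real ^ 'n \<Rightarrow> (real ^ 'n) \<times> (real ^ 'm)"
    using diff_times_on_jac[OF assms(1), of 0 Z] that K(2) by (auto intro: continuous_on_subset)
  have jac_t: "jac (\<lambda>x. ?F x + t *\<^sub>R V x) x = jac ?F x + t *\<^sub>R jac V x" if "x \<in> K" for t x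
  proof -
    have d: "?F differentiable at x" "V differentiable at x"
      using Fk[of 1] Vk[of 1] that K by auto
    then have "(\<lambda>x. t *\<^sub>R V x) differentiable at x" by simp
    with d show ?thesis
      by (simp add: vec_eq_iff partial_deriv_add partial_deriv_bounded_linear[OF bounded_linear_scaleR_right])
  qed
  have vol_eq: "volume_over K (\<lambda>x. ?F x + t *\<^sub>R V x) = (LINT x:K|lborel. vol (jac ?F x + t *\<^sub>R jac V x))" for t
    unfolding volume_over_eq
    by (intro set_lebesgue_integral_cong) (use K(1) jac_t in \<open>auto simp: borel_compact\<close>)
  note variation = volume_variation_derivatives[OF K(1) jac_c[OF Fk] jac_c[OF Vk] det1]
  have "0 \<le> (LINT x:K|lborel. flux_deriv (jac ?F x) (jac V x) \<bullet> jac V x)"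
    using V0 by (intro second_variation_graph_nonneg[OF assms(1,3,5) det4 V K]) auto
  then show "\<exists>A' s. (\<forall>\<^sub>F t in nhds 0.
        ((\<lambda>t. volume_over K (\<lambda>x. ?F x + t *\<^sub>R V x)) has_real_derivative A' t) (at t)) \<and>
      (A' has_real_derivative s) (at 0) \<and> s \<ge> 0"
    \<comment> \<open>The witnesses are the integral of \<open>flux\<close> paired with
      \<open>jac V\<close> along the variation, as first derivative, and the Hessian integral, as
      second derivative at 0.\<close>
    unfolding vol_eq by (intro exI conjI) (rule variation(1), assumption, rule variation(2), assumption)
qed

end
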